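(* Let $K$ be an algebraically closed field of arbitrary characteristic. For every $0\neq f\in\langle x,y\rangle\subset K[[x,y]]$ we have $\delta_N(f)\leq\delta(f)$, and if $f$ is weakly Newton non-degenerate (WNND), then $\delta_N(f)=\delta(f)$.
   Context: Write $f=\sum_\alpha a_\alpha x^{\alpha_1}y^{\alpha_2}$, $\operatorname{supp}(f)=\{\alpha\mid a_\alpha\neq 0\}$. The Newton diagram $\Gamma(f)$ is the union of the compact faces (vertices and edges) of the convex hull of $\bigcup_{\alpha\in\operatorname{supp}(f)}(\alpha+\mathbb{R}_{\geq0}^2)$; $\Gamma_-(f)$ is the union of all segments joining the origin to points of $\Gamma(f)$; $f$ is convenient if $\Gamma(f)$ meets both coordinate axes. The facets of $\Gamma(f)$ are its edges $\Delta_1,\ldots,\Delta_k$, and $l(\Delta_i)$ is the lattice length, i.e. the number of lattice points on $\Delta_i$ minus one. For a face $\Delta$ put $\operatorname{in}_\Delta(f)=\sum_{\alpha\in\Delta}a_\alpha x^{\alpha_1}y^{\alpha_2}$. $f$ is WNND if for every facet $\Delta$ of $\Gamma(f)$ the polynomial $g=\operatorname{in}_\Delta(f)$ and its partial derivatives $g_x,g_y$ have no common zero in $(K^* )^2$. Delta invariant: $\delta(f)=\sum_{Q\to 0}\frac{m_Q(m_Q-1)}{2}\in\mathbb{Z}_{\geq0}\cup\{\infty\}$, where the sum runs over the infinitely near points $Q$ of the origin (including the origin) in a minimal resolution of the singularity obtained by successively blowing up points, and $m_Q$ is the multiplicity of the strict transform of $f$ at $Q$ (so $\delta(f)=\infty$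 if $f$ is not reduced). Let $V_2$ be the area and $V_1$ the sum of the lengths of the intersections with the two coordinate axes. If $f$ is convenient, $\delta_N(f)=V_2(\Gamma_-(f))-\frac{V_1(\Gamma_-(f))}{2}+\frac{1}{2}\sum_{i=1}^k l(\Delta_i)$. Otherwise $\delta_N(f)=\sup\{\delta_N(f_m)\mid m\geq1\}$, where $f_m=f+x^m+y^m$ and no cancellation is allowed, i.e. the Newton diagram of $f_m$ is formed from the support $\operatorname{supp}(f)\cup\{(m,0),(0,m)\}$. *)

theory Defs
  imports "HOL-Analysis.Analysis" "HOL-Computational_Algebra.Computational_Algebra"
begin

unbundle no vec_syntax

text \<open>
  The ring \<open>K[[x,y]]\<close> is rendered as \<open>'a fps fps\<close>, where the outer variable is \<open>x\<close> and the inner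
  variable is \<open>y\<close>: the coefficient of \<open>x^i y^j\<close> in \<open>f\<close> is \<open>f $ i $ j\<close>.
\<close>

definition ser_x :: "'a::comm_ring_1 fps fps" where
  "ser_x = fps_X"

definition ser_y :: "'a::comm_ring_1 fps fps" where
  "ser_y = fps_const fps_X"

definition ideal_xy :: "'a::comm_ring_1 fps fps set" where
  "ideal_xy = {ser_x * g + ser_y * h | g h. True}"

definition supp :: "'a::zero fps fps \<Rightarrow> (nat \<times> nat) set" where
  "supp f = {(i, j). f $ i $ j \<noteq> 0}"


section \<open>Newton diagrams\<close>

definition newton_polyhedron :: "(nat \<times> nat) set \<Rightarrow> (real \<times> real) set" where
  "newton_polyhedron S =
     convex hull (\<Union>(i, j) \<in> S. {(real i + s, real j + t) | s t. 0 \<le> s \<and> 0 \<le> t})"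

text \<open>
  For \<open>S \<noteq> {}\<close> the Newton polyhedron is unbounded and two-dimensional, so that its nonempty compact
  faces are vertices and edges.
\<close>

definition newton_diagram :: "(nat \<times> nat) set \<Rightarrow> (real \<times> real) set" where
  "newton_diagram S = \<Union>{F. F face_of newton_polyhedron S \<and> compact F}"

definition newton_facets :: "(nat \<times> nat) set \<Rightarrow> (real \<times> real) set set" where
  "newton_facets S = {F. F edge_of newton_polyhedron S \<and> compact F}"

definition below_diagram :: "(nat \<times> nat) set \<Rightarrow> (real \<times> real) set" where
  "below_diagram S = (\<Union>p \<in> newton_diagram S. closed_segment 0 p)"

definition convenient :: "(nat \<times> nat) set \<Rightarrow> bool" where
  "convenient S \<longleftrightarrow>
     (\<exists>s. (s, 0) \<in> newton_diagram S) \<and> (\<exists>t. (0, t) \<in> newton_diagram S)"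

definition lattice_length :: "(real \<times> real) set \<Rightarrow> real" where
  "lattice_length F = real (card (F \<inter> \<int> \<times> \<int>)) - 1"

definition V2 :: "(real \<times> real) set \<Rightarrow> real" where
  "V2 A = measure lborel A"

definition V1 :: "(real \<times> real) set \<Rightarrow> real" where
  "V1 A = measure lborel {s. (s, 0) \<in> A} + measure lborel {t. (0, t) \<in> A}"

definition newton_number :: "(nat \<times> nat) set \<Rightarrow> real" where
  "newton_number S = V2 (below_diagram S) - V1 (below_diagram S) / 2
     + (\<Sum>F \<in> newton_facets S. lattice_length F) / 2"

definition delta_N :: "'a::zero fps fps \<Rightarrow> ereal" where
  "delta_N f =
     (if convenient (supp f) then ereal (newton_number (supp f))
      else (SUP m \<in> {1..}. ereal (newton_number (supp f \<union> {(m, 0), (0, m)}))))"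


section \<open>Weak Newton non-degeneracy\<close>

text \<open>
  Bivariate polynomials are elements of \<open>'a poly poly\<close>, again with \<open>x\<close> as the outer variable.
  The initial form is used for compact \<open>\<Delta>\<close> only, where the sum is finite.
\<close>

definition init_form :: "(real \<times> real) set \<Rightarrow> 'a::comm_ring_1 fps fps \<Rightarrow> 'a poly poly" where
  "init_form \<Delta> f =
     (\<Sum>(i, j) | (real i, real j) \<in> \<Delta>. monom (monom (f $ i $ j) j) i)"

definition eval2 :: "'a::comm_ring_1 poly poly \<Rightarrow> 'a \<Rightarrow> 'a \<Rightarrow> 'a" where
  "eval2 g a b = poly (poly g [:a:]) b"

definition deriv_x :: "'a::idom poly poly \<Rightarrow> 'a poly poly" where
  "deriv_x g = pderiv g"

definition deriv_y :: "'a::idom poly poly \<Rightarrow> 'a poly poly" where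
  "deriv_y g = map_poly pderiv g"

definition WNND :: "'a::idom fps fps \<Rightarrow> bool" where
  "WNND f \<longleftrightarrow>
     (\<forall>\<Delta> \<in> newton_facets (supp f). let g = init_form \<Delta> f in
        \<not> (\<exists>a b. a \<noteq> 0 \<and> b \<noteq> 0 \<and>
             eval2 g a b = 0 \<and> eval2 (deriv_x g) a b = 0 \<and> eval2 (deriv_y g) a b = 0))"


section \<open>Infinitely near points and the delta invariant\<close>

definition mult :: "'a::zero fps fps \<Rightarrow> nat" where
  "mult f = (LEAST n. \<exists>i j. i + j = n \<and> f $ i $ j \<noteq> 0)"

text \<open>
  The points of the exceptional divisor of the blow-up of the origin are encoded by \<open>'a option\<close>:
  \<open>Some c\<close> is the point with coordinates \<open>(0, c)\<close> in the chart \<open>(x, y) \<mapsto> (x, x y)\<close>, and \<open>None\<close> is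
  the origin of the chart \<open>(x, y) \<mapsto> (x y, y)\<close>.  The pull-back of \<open>f = \<Sum> a_ij x^i y^j\<close> to the first
  point, in local coordinates centred there, is
  \[ f (x, x (y + c)) = \sum_n x^n \sum_{j \le n} a_{n-j,j} (y + c)^j, \]
  and the pull-back to the second one is \<open>f (x y, y) = \<Sum> a_ij x^i y^(i+j)\<close>.  The exceptional divisor
  is \<open>x = 0\<close> and \<open>y = 0\<close>, respectively, and the strict transform is obtained by dividing by its
  \<open>mult f\<close>-th power.
\<close>

fun total_transform :: "'a::comm_ring_1 option \<Rightarrow> 'a fps fps \<Rightarrow> 'a fps fps" where
  "total_transform (Some c) f =
     Abs_fps (\<lambda>n. fps_of_poly (\<Sum>j\<le>n. smult (f $ (n - j) $ j) ([:c, 1:] ^ j)))"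
| "total_transform None f =
     Abs_fps (\<lambda>i. Abs_fps (\<lambda>k. if i \<le> k then f $ i $ (k - i) else 0))"

fun strict_transform :: "'a::comm_ring_1 option \<Rightarrow> 'a fps fps \<Rightarrow> 'a fps fps" where
  "strict_transform (Some c) f = fps_shift (mult f) (total_transform (Some c) f)"
| "strict_transform None f =
     Abs_fps (\<lambda>i. fps_shift (mult f) (total_transform None f $ i))"

text \<open>
  An infinitely near point of the origin is given by the list of points that lead to it: \<open>[]\<close> is the
  origin itself, and \<open>Q @ [d]\<close> is the point \<open>d\<close> of the exceptional divisor of the blow-up of \<open>Q\<close>.
\<close>

definition transform_at :: "'a::comm_ring_1 fps fps \<Rightarrow> 'a option list \<Rightarrow> 'a fps fps" where
  "transform_at f Q = fold strict_transform Q f"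

definition mult_at :: "'a::comm_ring_1 fps fps \<Rightarrow> 'a option list \<Rightarrow> nat" where
  "mult_at f Q = mult (transform_at f Q)"

text \<open>
  The points of the strict transforms of \<open>f\<close> that occur when singular points are blown up
  successively until none is left.  If this never happens, the set is infinite.
\<close>

inductive_set near_points :: "'a::comm_ring_1 fps fps \<Rightarrow> 'a option list set"
  for f :: "'a fps fps" where
  origin: "[] \<in> near_points f"
| blow_up: "Q \<in> near_points f \<Longrightarrow> mult_at f Q \<ge> 2 \<Longrightarrow> mult_at f (Q @ [d]) \<ge> 1
              \<Longrightarrow> Q @ [d] \<in> near_points f"

definition delta :: "'a::comm_ring_1 fps fps \<Rightarrow> enat" where
  "delta f = (\<Sum>\<^sub>\<infinity>Q \<in> near_points f. enat (mult_at f Q * (mult_at f Q - 1) div 2))"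

end

(*
  Everything is expressed through functionals (p, q) with p, q > 0: a point z lies below the Newton
  diagram of S iff (p, q) . z is at most the minimum of (p, q) over S for some such functional.
  By Pick's theorem the Newton number should be the number of lattice points with positive
  coordinates below the diagram.  In the two toric charts the blow-up acts on exponents by the
  unimodular affine maps (i, j) -> (i + j - m, j) and (i, j) -> (i, i + j - m), which turn functionals
  with q > p and with p > q into arbitrary positive functionals.  Hence the region below the diagram
  is the disjoint union of the triangle i + j <= m and of the regions of the two blow-ups; area,
  intercepts, edges and lattice points all decompose accordingly, which proves the lattice point
  formula by induction, without Pick's theorem.  The triangle contains m (m - 1) / 2 positive lattice
  points, the contribution of the origin to delta.  So delta_N satisfies the recursion of delta
  restricted to the two torus-fixed points of each exceptional divisor, which gives the inequality.
  Non-degeneracy is inherited by the two toric strict transforms and forces all other points of the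
  exceptional divisor to have multiplicity at most one, which gives equality.
*)
theory Submission
  imports Defs
begin

section \<open>Faces of the Newton polyhedron\<close>

text \<open>Strictly positive weights single out the compact faces; a supporting functional with a
  zero weight has to be tilted, which is possible because exponents are integers.
  \<open>delta_N\<close> is awkward to carry through blow-ups: one branch is a supremum over
  auxiliary diagrams. The set of inner points makes sense for every diagram, so that branch is
  removed once and for all: an inner point is certified by a single functional, and that functional
  survives adding (m, 0) and (0, m) for large m. What remains are counts in \<open>enat\<close>.
  Each of the three inductions needs its own measure: the sum of the intercepts for the lattice
  point formula, the value of \<open>delta\<close> for the inequality (infinite \<open>delta\<close>
  being trivial), and the number of inner points for the equality (if infinite, the inequality
  suffices). The characteristic does not enter because g_x and g_y are replaced by x g_x and y g_y,
  which weight the terms of g by their exponents. Exponents change by integral affine maps, and on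
  the tangent cone they satisfy i + j = m, so no integer is ever divided by.\<close>

definition real_pt :: "nat \<times> nat \<Rightarrow> real \<times> real" where
  "real_pt z = (real (fst z), real (snd z))"

definition under :: "real \<Rightarrow> real \<Rightarrow> (nat \<times> nat) set \<Rightarrow> real \<times> real \<Rightarrow> bool" where
  "under p q S z \<longleftrightarrow> (\<forall>(a, b)\<in>S. p * fst z + q * snd z \<le> p * real a + q * real b)"

text \<open>For convenient supports this is the union of segments \<open>below_diagram\<close>. The
  description by functionals is the one that behaves well under affine maps of exponents.\<close>

definition region :: "(nat \<times> nat) set \<Rightarrow> (real \<times> real) set" where
  "region S = {z. 0 \<le> fst z \<and> 0 \<le> snd z \<and> (\<exists>p>0. \<exists>q>0. under p q S z)}"

definition min_points :: "real \<Rightarrow> real \<Rightarrow> (nat \<times> nat) set \<Rightarrow> (nat \<times> nat) set" where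
  "min_points p q S = {z \<in> S. under p q S (real_pt z)}"

definition min_face :: "real \<Rightarrow> real \<Rightarrow> (nat \<times> nat) set \<Rightarrow> (real \<times> real) set" where
  "min_face p q S = convex hull (real_pt ` min_points p q S)"

lemma underD: "under p q S z \<Longrightarrow> (a, b) \<in> S \<Longrightarrow> p * fst z + q * snd z \<le> p * real a + q * real b"
  by (auto simp: under_def)

lemma regionI:
  "under p q S z \<Longrightarrow> 0 < p \<Longrightarrow> 0 < q \<Longrightarrow> 0 \<le> fst z \<Longrightarrow> 0 \<le> snd z \<Longrightarrow> z \<in> region S"
  unfolding region_def by blast

lemma inj_real_pt: "inj real_pt"
  by (auto simp: inj_def real_pt_def prod_eq_iff)

text \<open>Convex hulls commute with Minkowski sums, and the quadrant is its own hull.\<close>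

lemma newton_polyhedron_sum:
  "newton_polyhedron S = {x + y | x y. x \<in> convex hull (real_pt ` S) \<and> y \<in> {0..} \<times> {0..}}"
proof -
  have cvx: "convex ({0..} \<times> {0..} :: (real \<times> real) set)"
    by (intro convex_Times convex_real_interval)
  have "(\<Union>(i, j) \<in> S. {(real i + s, real j + t) | s t. 0 \<le> s \<and> 0 \<le> t})
      = (\<Union>x\<in>real_pt ` S. \<Union>y\<in>{0..} \<times> {0..}. {x + y})"
    by (force simp: real_pt_def)
  then have "newton_polyhedron S
      = convex hull (\<Union>x\<in>real_pt ` S. \<Union>y\<in>{0..} \<times> {0..}. {x + y})"
    by (simp add: newton_polyhedron_def)
  also have "\<dots> = convex hull (real_pt ` S + {0..} \<times> {0..})"
    by (rule arg_cong[of _ _ "\<lambda>A. convex hull A"]) (auto simp: set_plus_def)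
  also have "\<dots> = convex hull (real_pt ` S) + {0..} \<times> {0..}"
    by (simp add: convex_hull_set_plus hull_same[of convex, OF cvx])
  finally show ?thesis
    unfolding set_plus_def by blast
qed

lemma convex_newton_polyhedron: "convex (newton_polyhedron S)"
  by (simp add: newton_polyhedron_def)

lemma real_pt_in_newton_polyhedron: "z \<in> S \<Longrightarrow> real_pt z \<in> newton_polyhedron S"
  unfolding newton_polyhedron_sum
  by (intro CollectI exI[of _ "real_pt z"] exI[of _ "(0, 0)"] conjI hull_inc) (auto simp: prod_eq_iff)

lemma newton_polyhedron_upward:
  assumes "z \<in> newton_polyhedron S" "0 \<le> s" "0 \<le> t"
  shows "z + (s, t) \<in> newton_polyhedron S"
proof -
  obtain x y where xy: "z = x + y" "x \<in> convex hull (real_pt ` S)" "y \<in> {0..} \<times> {0..}"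
    using assms(1) unfolding newton_polyhedron_sum by blast
  then have "z + (s, t) = x + (y + (s, t))" "y + (s, t) \<in> {0..} \<times> {0..}"
    using assms by (auto simp: add.assoc)
  then show ?thesis
    unfolding newton_polyhedron_sum using xy(2) by (intro CollectI exI conjI)
qed

lemma newton_polyhedron_bound:
  assumes "z \<in> newton_polyhedron S" and pq: "0 \<le> p" "0 \<le> q"
    and bound: "\<And>i j. (i, j) \<in> S \<Longrightarrow> c \<le> p * real i + q * real j"
  shows "c \<le> p * fst z + q * snd z"
proof -
  have "newton_polyhedron S \<subseteq> {w. c \<le> (p, q) \<bullet> w}"
    unfolding newton_polyhedron_def
  proof (rule hull_minimal)
    show "(\<Union>(i, j) \<in> S. {(real i + s, real j + t) | s t. 0 \<le> s \<and> 0 \<le> t}) \<subseteq> {w. c \<le> (p, q) \<bullet> w}"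
    proof (clarsimp simp: inner_prod_def)
      fix i j and s t :: real
      assume "(i, j) \<in> S" "0 \<le> s" "0 \<le> t"
      then show "c \<le> p * (real i + s) + q * (real j + t)"
        using bound[of i j] mult_nonneg_nonneg[OF pq(1), of s] mult_nonneg_nonneg[OF pq(2), of t]
        by (simp add: distrib_left)
    qed
    show "convex {w. c \<le> (p, q) \<bullet> w}"
      by (rule convex_halfspace_ge)
  qed
  then show ?thesis
    using assms(1) by (auto simp: inner_prod_def)
qed

lemma under_iff_newton_polyhedron:
  assumes "0 \<le> p" "0 \<le> q"
  shows "under p q S z \<longleftrightarrow> (\<forall>w\<in>newton_polyhedron S. p * fst z + q * snd z \<le> p * fst w + q * snd w)"
proof
  assume "under p q S z"
  then show "\<forall>w\<in>newton_polyhedron S. p * fst z + q * snd z \<le> p * fst w + q * snd w"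
    using assms by (auto intro!: newton_polyhedron_bound dest: underD)
next
  assume "\<forall>w\<in>newton_polyhedron S. p * fst z + q * snd z \<le> p * fst w + q * snd w"
  then show "under p q S z"
    using real_pt_in_newton_polyhedron unfolding under_def by (fastforce simp: real_pt_def)
qed

lemma finite_under:
  assumes "S \<noteq> {}" "0 < p" "0 < q"
  shows "finite {z. under p q S (real_pt z)}"
proof -
  obtain a b where ab: "(a, b) \<in> S" using assms by auto
  define c where "c = p * real a + q * real b"
  have "{z. under p q S (real_pt z)} \<subseteq> {..nat \<lceil>c / p\<rceil>} \<times> {..nat \<lceil>c / q\<rceil>}"
  proof clarsimp
    fix i j assume "under p q S (real_pt (i, j))"
    then have *: "p * real i + q * real j \<le> c"
      using underD ab by (fastforce simp: real_pt_def c_def)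
    have "p * real i \<ge> 0" "q * real j \<ge> 0" using assms by auto
    then have "p * real i \<le> c" "q * real j \<le> c" using * by linarith+
    then have "real i \<le> c / p" "real j \<le> c / q"
      using assms by (simp_all add: pos_le_divide_eq mult.commute)
    then show "i \<le> nat \<lceil>c / p\<rceil> \<and> j \<le> nat \<lceil>c / q\<rceil>" by linarith
  qed
  then show ?thesis by (rule finite_subset) simp
qed

lemma finite_min_points:
  assumes "0 < p" "0 < q"
  shows "finite (min_points p q S)"
  using finite_under[OF _ assms, of S]
  by (cases "S = {}") (auto simp: min_points_def elim: rev_finite_subset)

lemma compact_min_face: "0 < p \<Longrightarrow> 0 < q \<Longrightarrow> compact (min_face p q S)"
  unfolding min_face_def by (intro finite_imp_compact_convex_hull finite_imageI finite_min_points)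

text \<open>A minimiser is a convex combination of support points plus a quadrant vector. All
  excesses over the minimum are nonnegative and add up to zero, so the quadrant vector vanishes and
  only minimising support points carry weight.\<close>

lemma min_face_eq:
  assumes pq: "0 < p" "0 < q"
  shows "min_face p q S = {z \<in> newton_polyhedron S. under p q S z}"
proof
  show "min_face p q S \<subseteq> {z \<in> newton_polyhedron S. under p q S z}"
    unfolding min_face_def
  proof (rule hull_minimal)
    show "real_pt ` min_points p q S \<subseteq> {z \<in> newton_polyhedron S. under p q S z}"
      by (auto simp: min_points_def real_pt_in_newton_polyhedron)
    have "{z. under p q S z} = (\<Inter>(a,b)\<in>S. {z. (p, q) \<bullet> z \<le> p * real a + q * real b})"
      by (auto simp: under_def inner_prod_def)
    moreover have "convex \<dots>"
      by (auto intro!: convex_INT convex_halfspace_le)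
    ultimately have "convex {z. under p q S z}" by simp
    then show "convex {z \<in> newton_polyhedron S. under p q S z}"
      using convex_Int[OF convex_newton_polyhedron, of "{z. under p q S z}"] by (simp add: Int_def)
  qed
  show "{z \<in> newton_polyhedron S. under p q S z} \<subseteq> min_face p q S"
  proof
    fix z assume "z \<in> {z \<in> newton_polyhedron S. under p q S z}"
    then obtain x y where xy: "z = x + y" "x \<in> convex hull (real_pt ` S)" "y \<in> {0..} \<times> {0..}"
      and z: "under p q S z"
      unfolding newton_polyhedron_sum by blast
    define h where "h w = p * fst w + q * snd w" for w :: "real \<times> real"
    have h_add: "h (v + w) = h v + h w" for v w by (simp add: h_def algebra_simps)
    have zle: "h z \<le> h (real_pt s)" if "s \<in> S" for s
      using underD[OF z, of "fst s" "snd s"] that by (simp add: h_def real_pt_def)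
    obtain T u where T: "finite T" "T \<subseteq> real_pt ` S" "\<forall>v\<in>T. 0 \<le> u v" "sum u T = 1"
        "(\<Sum>v\<in>T. u v *\<^sub>R v) = x"
      using xy(2) unfolding convex_hull_explicit by blast
    have hx: "h x = (\<Sum>v\<in>T. u v * h v)"
      unfolding T(5)[symmetric]
      by (simp add: h_def fst_sum snd_sum sum_distrib_left sum.distrib[symmetric] algebra_simps)
    have nonneg: "0 \<le> u v * (h v - h z)" if "v \<in> T" for v
      using that T zle by (intro mult_nonneg_nonneg) auto
    have "(\<Sum>v\<in>T. u v * (h v - h z)) = h x - h z"
      using hx T(4) by (simp add: algebra_simps sum_subtractf sum_distrib_left[symmetric])
    moreover have hz: "h z = h x + h y" by (simp add: xy h_add)
    moreover have hy: "0 \<le> h y" using xy(3) pq by (auto simp: h_def)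
    moreover have "0 \<le> (\<Sum>v\<in>T. u v * (h v - h z))" using nonneg by (rule sum_nonneg)
    ultimately have "h y = 0" and s0: "(\<Sum>v\<in>T. u v * (h v - h z)) = 0" by linarith+
    have y0: "y = 0"
    proof -
      obtain y1 y2 where y12: "y = (y1, y2)" by (cases y)
      then have "0 \<le> p * y1" "0 \<le> q * y2" using xy(3) pq by auto
      moreover have "p * y1 + q * y2 = 0" using \<open>h y = 0\<close> y12 by (simp add: h_def)
      ultimately have "p * y1 = 0" "q * y2 = 0" by linarith+
      then show ?thesis using pq y12 by (simp add: zero_prod_def)
    qed
    have each: "u v = 0 \<or> h v = h z" if "v \<in> T" for v
      using s0 that T(1) nonneg by (simp add: sum_nonneg_eq_0_iff)
    define T' where "T' = {v \<in> T. u v \<noteq> 0}"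
    have "T' \<subseteq> real_pt ` min_points p q S"
    proof
      fix v assume "v \<in> T'"
      then have v: "v \<in> T" "h v = h z" using each unfolding T'_def by blast+
      then obtain s where s: "s \<in> S" "v = real_pt s" using T(2) by blast
      then have "under p q S (real_pt s)"
        using z v(2) by (simp add: under_def h_def)
      then show "v \<in> real_pt ` min_points p q S" using s by (auto simp: min_points_def)
    qed
    moreover have "sum u T' = sum u T" "(\<Sum>v\<in>T'. u v *\<^sub>R v) = (\<Sum>v\<in>T. u v *\<^sub>R v)"
      unfolding T'_def by (rule sum.mono_neutral_left[OF T(1)]; simp)+
    then have "sum u T' = 1" "(\<Sum>v\<in>T'. u v *\<^sub>R v) = x" using T by simp_all
    moreover have "finite T'" "\<forall>v\<in>T'. 0 \<le> u v" using T(1,3) by (auto simp: T'_def)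
    ultimately have "x \<in> min_face p q S"
      unfolding min_face_def convex_hull_explicit by blast
    then show "z \<in> min_face p q S" using xy(1) y0 by simp
  qed
qed

lemma min_face_face_of:
  assumes "0 < p" "0 < q"
  shows "min_face p q S face_of newton_polyhedron S"
proof (cases "min_face p q S = {}")
  case False
  then obtain z where z: "z \<in> newton_polyhedron S" "under p q S z"
    using min_face_eq[OF assms] by blast
  have ge: "(p, q) \<bullet> z \<le> (p, q) \<bullet> w" if "w \<in> newton_polyhedron S" for w
    using z(2) that assms by (simp add: under_iff_newton_polyhedron inner_prod_def)
  have "min_face p q S = newton_polyhedron S \<inter> {w. (p, q) \<bullet> w = (p, q) \<bullet> z}"
  proof (rule set_eqI)
    fix w
    show "w \<in> min_face p q S \<longleftrightarrow> w \<in> newton_polyhedron S \<inter> {w. (p, q) \<bullet> w = (p, q) \<bullet> z}"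
      using z ge[of w] assms unfolding min_face_eq[OF assms]
      by (auto simp: under_iff_newton_polyhedron inner_prod_def intro: antisym)
  qed
  then show ?thesis
    using face_of_Int_supporting_hyperplane_ge[OF convex_newton_polyhedron ge] by simp
qed simp

text \<open>Since the polyhedron is closed upward, a supporting functional at \<open>x\<close> has
  nonnegative weights. If one of them is zero, \<open>x\<close> lies on an extreme vertical or
  horizontal line. It is the lowest point of the polyhedron there, as otherwise the face would
  contain a ray. So \<open>x\<close> is a support point, and the functional can be tilted to have
  positive weights.\<close>

lemma compact_face_functional:
  assumes S: "S \<noteq> {}" and F: "F face_of newton_polyhedron S" "compact F" "x \<in> F"
  obtains p q where "0 < p" "0 < q" "under p q S x"
proof -
  let ?N = "newton_polyhedron S"
  have FN: "F \<subseteq> ?N" using F(1) by (rule face_of_imp_subset)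
  have up: "x + (s, t) \<notin> F" if st: "s = 0 \<or> t = 0" "0 \<le> s" "0 \<le> t" "s + t \<noteq> 0"
    and "\<And>r. 0 \<le> r \<Longrightarrow> x + (r * s, r * t) \<in> F" for s t
  proof -
    obtain B where B: "\<And>y. y \<in> F \<Longrightarrow> norm y \<le> B"
      using compact_imp_bounded[OF F(2)] by (auto simp: bounded_iff)
    \<comment> \<open>Far enough along the ray to leave the ball of radius \<open>B\<close> that
      contains \<open>F\<close>.\<close>
    define r where "r = (B + norm x + 1) / (s + t)"
    have "0 \<le> B" using B[OF F(3)] norm_ge_zero order_trans by blast
    then have r0: "0 \<le> r" unfolding r_def using st by (auto intro!: divide_nonneg_nonneg)
    have "norm (r * s, r * t) = r * (s + t)"
      using st r0 by (auto simp: norm_Pair abs_mult)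
    also have "\<dots> = B + norm x + 1" using st by (simp add: r_def)
    finally have "norm (r * s, r * t) = B + norm x + 1" .
    moreover have "norm (r * s, r * t) \<le> norm (x + (r * s, r * t)) + norm x"
      by (metis add_diff_cancel_left' norm_triangle_ineq4)
    ultimately show ?thesis using B[OF that(5)[OF r0]] by linarith
  qed
  have N0: "x \<in> ?N" using F FN by auto
  have not_ray: False if st: "s = 0 \<or> t = 0" "0 \<le> s" "0 \<le> t" "s + t \<noteq> 0"
    and ray: "\<And>r. 0 \<le> r \<Longrightarrow> x + (r * s, r * t) \<in> F" for s t
    using up[OF st ray] ray[of 1] by auto
  \<comment> \<open>If a point behind \<open>x\<close> were in the polyhedron, \<open>x\<close>
    would be interior to segments running from it to all points ahead, and the face property would
    put the whole ray into \<open>F\<close>.\<close>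
  have down: "x - (s, t) \<notin> ?N" if st: "s = 0 \<or> t = 0" "0 \<le> s" "0 \<le> t" "s + t \<noteq> 0" for s t
  proof
    assume lower: "x - (s, t) \<in> ?N"
    show False
    proof (rule not_ray[OF st])
      fix r :: real assume r: "0 \<le> r"
      show "x + (r * s, r * t) \<in> F"
      proof (cases "r = 0")
        case True then show ?thesis using F(3) by (cases x) simp
      next
        case False
        have st0: "(s, t) \<noteq> 0" using st by (auto simp: zero_prod_def)
        have "x + (r * s, r * t) \<in> ?N"
          using newton_polyhedron_upward[OF N0] r st by auto
        moreover have "x \<in> open_segment (x - (s, t)) (x + (r * s, r * t))"
        proof -
          \<comment> \<open>The position of \<open>x\<close> between one step back and
            \<open>r\<close> steps ahead.\<close>
          define u where "u = 1 / (1 + r)"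
          have u: "0 < u" "u < 1" "u * (1 + r) = 1" using r False by (auto simp: u_def)
          have e: "(1 - u) *\<^sub>R (x - (s, t)) + u *\<^sub>R (x + (r * s, r * t)) = x + (u * (1 + r) - 1) *\<^sub>R (s, t)"
            by (simp add: algebra_simps prod_eq_iff)
          have "x = (1 - u) *\<^sub>R (x - (s, t)) + u *\<^sub>R (x + (r * s, r * t))"
            unfolding e u(3) by (simp add: prod_eq_iff)
          moreover have "x - (s, t) \<noteq> x + (r * s, r * t)"
          proof
            assume "x - (s, t) = x + (r * s, r * t)"
            then have "(1 + r) * s = 0" "(1 + r) * t = 0" by (auto simp: prod_eq_iff algebra_simps)
            then show False using r st by auto
          qed
          ultimately show ?thesis unfolding in_segment using u by blast
        qed
        ultimately show ?thesis
          using F(1,3) lower unfolding face_of_def by blast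
      qed
    qed
  qed
  have ne: "F \<noteq> ?N"
  proof
    assume "F = ?N"
    then show False
      using not_ray[of 1 0] newton_polyhedron_upward[OF N0] by auto
  qed
  then have "x \<notin> rel_interior ?N"
    using face_of_disjoint_rel_interior[OF F(1)] F(3) by blast
  then obtain v where v: "v \<noteq> 0" "\<And>y. y \<in> ?N \<Longrightarrow> v \<bullet> x \<le> v \<bullet> y"
    by (rule supporting_hyperplane_rel_boundary[OF convex_newton_polyhedron N0]) (rule that)
  obtain p q where pq: "v = (p, q)" by (cases v)
  have le: "p * fst x + q * snd x \<le> p * fst y + q * snd y" if "y \<in> ?N" for y
    using v(2)[OF that] by (simp add: pq inner_prod_def)
  have p0: "0 \<le> p" using le[OF newton_polyhedron_upward[OF N0, of 1 0]] by (simp add: algebra_simps)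
  have q0: "0 \<le> q" using le[OF newton_polyhedron_upward[OF N0, of 0 1]] by (simp add: algebra_simps)
  consider "0 < p" "0 < q" | "q = 0" "0 < p" | "p = 0" "0 < q"
    using p0 q0 v(1) pq by (fastforce simp: zero_prod_def)
  then show thesis
  proof cases
    case 1
    then show ?thesis using that le p0 q0 by (simp add: under_iff_newton_polyhedron)
  next
    case 2
    define c where "c = (LEAST c. \<exists>j. (c, j) \<in> S)"
    have "\<exists>j. (c, j) \<in> S" unfolding c_def
      by (rule LeastI_ex[of "\<lambda>c. \<exists>j. (c, j) \<in> S"]) (use S in auto)
    define d where "d = (LEAST j. (c, j) \<in> S)"
    have cd: "(c, d) \<in> S" unfolding d_def using \<open>\<exists>j. (c, j) \<in> S\<close> by (rule LeastI_ex)
    have cle: "c \<le> i" if "(i, j) \<in> S" for i j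
      unfolding c_def using that by (auto intro: Least_le)
    have dle: "d \<le> j" if "(c, j) \<in> S" for j
      unfolding d_def using that by (rule Least_le)
    \<comment> \<open>Every other column has index at least \<open>c + 1\<close>, so weight
      \<open>d + 1\<close> gains more there than the at most \<open>d\<close> that the second
      coordinate can lose.\<close>
    define r where "r = real d + 1"
    have S_bound: "r * real c + real d \<le> r * real i + 1 * real j" if "(i, j) \<in> S" for i j
    proof (cases "i = c")
      case True then show ?thesis using dle that by auto
    next
      case False
      then have "real i \<ge> real c + 1" using cle[OF that] by simp
      then have "r * real i \<ge> r * (real c + 1)" unfolding r_def by (intro mult_left_mono) auto
      then show ?thesis by (simp add: r_def algebra_simps)
    qed
    have "p * fst x \<le> p * real c"
      using le[OF real_pt_in_newton_polyhedron[OF cd]] 2 by (simp add: real_pt_def)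
    then have "fst x \<le> real c" using 2 by simp
    moreover have "1 * real c \<le> 1 * fst x + 0 * snd x"
      by (rule newton_polyhedron_bound[OF N0]) (auto dest: cle)
    ultimately have x1: "fst x = real c" by simp
    have "snd x \<le> real d"
    proof (rule ccontr)
      assume "\<not> snd x \<le> real d"
      then have "x - (0, snd x - real d) \<notin> ?N" by (intro down) auto
      moreover have "x - (0, snd x - real d) = real_pt (c, d)"
        by (simp add: real_pt_def prod_eq_iff x1)
      ultimately show False using real_pt_in_newton_polyhedron[OF cd] by simp
    qed
    then have "under r 1 S x"
      unfolding under_def using S_bound x1 by fastforce
    then show ?thesis using that[of r 1] by (simp add: r_def)
  next
    case 3
    define d where "d = (LEAST d. \<exists>i. (i, d) \<in> S)"
    have "\<exists>i. (i, d) \<in> S" unfolding d_def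
      by (rule LeastI_ex[of "\<lambda>d. \<exists>i. (i, d) \<in> S"]) (use S in auto)
    define c where "c = (LEAST i. (i, d) \<in> S)"
    have cd: "(c, d) \<in> S" unfolding c_def using \<open>\<exists>i. (i, d) \<in> S\<close> by (rule LeastI_ex)
    have dle: "d \<le> j" if "(i, j) \<in> S" for i j
      unfolding d_def using that by (auto intro: Least_le)
    have cle: "c \<le> i" if "(i, d) \<in> S" for i
      unfolding c_def using that by (rule Least_le)
    define r where "r = real c + 1"
    have S_bound: "real c + r * real d \<le> 1 * real i + r * real j" if "(i, j) \<in> S" for i j
    proof (cases "j = d")
      case True then show ?thesis using cle that by auto
    next
      case False
      then have "real j \<ge> real d + 1" using dle[OF that] by simp
      then have "r * real j \<ge> r * (real d + 1)" unfolding r_def by (intro mult_left_mono) auto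
      then show ?thesis by (simp add: r_def algebra_simps)
    qed
    have "q * snd x \<le> q * real d"
      using le[OF real_pt_in_newton_polyhedron[OF cd]] 3 by (simp add: real_pt_def)
    then have "snd x \<le> real d" using 3 by simp
    moreover have "1 * real d \<le> 0 * fst x + 1 * snd x"
      by (rule newton_polyhedron_bound[OF N0]) (auto dest: dle)
    ultimately have x2: "snd x = real d" by simp
    have "fst x \<le> real c"
    proof (rule ccontr)
      assume "\<not> fst x \<le> real c"
      then have "x - (fst x - real c, 0) \<notin> ?N" by (intro down) auto
      moreover have "x - (fst x - real c, 0) = real_pt (c, d)"
        by (simp add: real_pt_def prod_eq_iff x2)
      ultimately show False using real_pt_in_newton_polyhedron[OF cd] by simp
    qed
    then have "under 1 r S x"
      unfolding under_def using S_bound x2 by fastforce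
    then show ?thesis using that[of 1 r] by (simp add: r_def)
  qed
qed

lemma aff_dim_min_face_le:
  assumes "0 < p" "0 < q"
  shows "aff_dim (min_face p q S) \<le> 1"
proof (cases "min_face p q S = {}")
  case False
  then obtain z where z: "z \<in> min_face p q S" by blast
  have "min_face p q S \<subseteq> {w. (p, q) \<bullet> w = (p, q) \<bullet> z}"
    using z unfolding min_face_eq[OF assms]
    using assms by (force simp: under_iff_newton_polyhedron inner_prod_def)
  then have "aff_dim (min_face p q S) \<le> aff_dim {w. (p, q) \<bullet> w = (p, q) \<bullet> z}"
    by (rule aff_dim_subset)
  also have "\<dots> = 1"
    using assms by (subst aff_dim_hyperplane) (auto simp: zero_prod_def)
  finally show ?thesis .
qed simp

text \<open>Two minimising support points distinguish the normal directions of edges from those of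
  vertices.\<close>

definition facet_weights :: "real \<Rightarrow> real \<Rightarrow> (nat \<times> nat) set \<Rightarrow> bool" where
  "facet_weights p q S \<longleftrightarrow> 0 < p \<and> 0 < q \<and> (\<exists>u\<in>min_points p q S. \<exists>v\<in>min_points p q S. u \<noteq> v)"

text \<open>A relative interior point of an edge minimises some positive functional, so the edge is
  a face of the corresponding \<open>min_face\<close>. That face has dimension at most one, and
  proper faces have smaller dimension, so the two agree.\<close>

lemma newton_facets_eq:
  assumes S: "S \<noteq> {}"
  shows "newton_facets S = {min_face p q S | p q. facet_weights p q S}"
proof
  let ?N = "newton_polyhedron S"
  show "newton_facets S \<subseteq> {min_face p q S | p q. facet_weights p q S}"
  proof
    fix F assume "F \<in> newton_facets S"
    then have F: "F face_of ?N" "aff_dim F = 1" "compact F"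
      by (auto simp: newton_facets_def edge_of_def)
    then have "rel_interior F \<noteq> {}"
      using face_of_imp_convex[OF F(1)] rel_interior_eq_empty by force
    then obtain x where x: "x \<in> rel_interior F" by blast
    then have "x \<in> F" using rel_interior_subset by blast
    then obtain p q where pq: "0 < p" "0 < q" "under p q S x"
      using compact_face_functional[OF S F(1,3)] by blast
    let ?F = "min_face p q S"
    have "F \<subseteq> ?N" using F(1) by (rule face_of_imp_subset)
    then have "x \<in> ?F" using pq \<open>x \<in> F\<close> by (auto simp: min_face_eq)
    then have FF: "F \<subseteq> ?F"
      using subset_of_face_of[OF min_face_face_of[OF pq(1,2)] \<open>F \<subseteq> ?N\<close>] x by blast
    have "F face_of ?F"
      using face_of_subset[OF F(1) FF face_of_imp_subset[OF min_face_face_of[OF pq(1,2)]]] .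
    then have eq: "F = ?F"
      using face_of_aff_dim_lt[of ?F F] aff_dim_min_face_le[OF pq(1,2), of S] F(2)
      by (force simp: min_face_def)
    have "\<exists>u\<in>min_points p q S. \<exists>v\<in>min_points p q S. u \<noteq> v"
    proof (rule ccontr)
      assume *: "\<not> ?thesis"
      have "min_points p q S \<noteq> {}" using \<open>x \<in> ?F\<close> by (auto simp: min_face_def)
      then obtain u where "u \<in> min_points p q S" by blast
      then have "min_points p q S = {u}" using * by (auto simp del: split_paired_All split_paired_Ex)
      then have "?F = {real_pt u}" by (simp add: min_face_def)
      then show False using eq F(2) by simp
    qed
    then show "F \<in> {min_face p q S | p q. facet_weights p q S}"
      using eq pq unfolding facet_weights_def by blast
  qed
  show "{min_face p q S | p q. facet_weights p q S} \<subseteq> newton_facets S"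
  proof clarify
    fix p q assume "facet_weights p q S"
    then obtain u v where pq: "0 < p" "0 < q" and uv: "u \<in> min_points p q S" "v \<in> min_points p q S" "u \<noteq> v"
      by (auto simp: facet_weights_def)
    have "{real_pt u, real_pt v} \<subseteq> min_face p q S"
      using uv by (auto simp: min_face_def intro: hull_inc)
    then have "aff_dim {real_pt u, real_pt v} \<le> aff_dim (min_face p q S)"
      by (rule aff_dim_subset)
    moreover have "real_pt u \<noteq> real_pt v" using uv(3) inj_real_pt by (auto dest: injD)
    ultimately have "aff_dim (min_face p q S) = 1"
      using aff_dim_min_face_le[OF pq, of S] by (simp add: aff_dim_2)
    then show "min_face p q S \<in> newton_facets S"
      using pq by (simp add: newton_facets_def edge_of_def min_face_face_of compact_min_face)
  qed
qed

section \<open>The region below the Newton diagram\<close>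

lemma newton_diagram_iff:
  assumes "S \<noteq> {}"
  shows "x \<in> newton_diagram S \<longleftrightarrow> x \<in> newton_polyhedron S \<and> (\<exists>p>0. \<exists>q>0. under p q S x)"
proof
  assume "x \<in> newton_diagram S"
  then obtain F where F: "F face_of newton_polyhedron S" "compact F" "x \<in> F"
    by (auto simp: newton_diagram_def)
  then have "x \<in> newton_polyhedron S" using face_of_imp_subset by blast
  then show "x \<in> newton_polyhedron S \<and> (\<exists>p>0. \<exists>q>0. under p q S x)"
    using compact_face_functional[OF assms F] by blast
next
  assume "x \<in> newton_polyhedron S \<and> (\<exists>p>0. \<exists>q>0. under p q S x)"
  then obtain p q where pq: "0 < p" "0 < q" "x \<in> min_face p q S"
    by (auto simp: min_face_eq)
  then show "x \<in> newton_diagram S"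
    unfolding newton_diagram_def using min_face_face_of compact_min_face by blast
qed

text \<open>If no support point lies on an axis, the other coordinate is at least 1 on the support,
  hence on the whole polyhedron, which then misses that axis.\<close>

lemma convenient_axis_points:
  assumes "convenient S"
  obtains a b where "(a, 0) \<in> S" "(0, b) \<in> S"
proof -
  obtain s t where st: "(s, 0) \<in> newton_diagram S" "(0, t) \<in> newton_diagram S"
    using assms by (auto simp: convenient_def)
  then have N: "(s, 0) \<in> newton_polyhedron S" "(0, t) \<in> newton_polyhedron S"
    by (auto simp: newton_diagram_def dest!: face_of_imp_subset)
  have "\<exists>a. (a, 0) \<in> S"
  proof (rule ccontr)
    assume *: "\<nexists>a. (a, 0) \<in> S"
    have "1 \<le> 0 * fst (s, 0::real) + 1 * snd (s, 0::real)"
    proof (rule newton_polyhedron_bound[OF N(1)])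
      fix i j assume "(i, j) \<in> S"
      then have "j \<noteq> 0" using * by metis
      then show "1 \<le> 0 * real i + 1 * real j" by simp
    qed auto
    then show False by simp
  qed
  moreover have "\<exists>b. (0, b) \<in> S"
  proof (rule ccontr)
    assume *: "\<nexists>b. (0, b) \<in> S"
    have "1 \<le> 1 * fst (0::real, t) + 0 * snd (0::real, t)"
    proof (rule newton_polyhedron_bound[OF N(2)])
      fix i j assume "(i, j) \<in> S"
      then have "i \<noteq> 0" using * by metis
      then show "1 \<le> 1 * real i + 0 * real j" by simp
    qed auto
    then show False by simp
  qed
  ultimately show thesis using that by blast
qed

text \<open>The support may be infinite, but points outside the box with corner (a, b) are dominated
  by (a, 0) or (0, b). So the polyhedron is a compact polygon plus the closed quadrant.\<close>

lemma closed_newton_polyhedron: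
  assumes "(a, 0) \<in> S" "(0, b) \<in> S"
  shows "closed (newton_polyhedron S)"
proof -
  let ?B = "S \<inter> {..a} \<times> {..b}"
  have "newton_polyhedron S = newton_polyhedron ?B"
    unfolding newton_polyhedron_def
  proof (intro arg_cong[of _ _ "\<lambda>A. convex hull A"] equalityI subsetI)
    fix z :: "real \<times> real"
    assume "z \<in> (\<Union>(i, j) \<in> S. {(real i + s, real j + t) | s t. 0 \<le> s \<and> 0 \<le> t})"
    then obtain i j s t where z: "(i, j) \<in> S" "z = (real i + s, real j + t)" "0 \<le> s" "0 \<le> t" by auto
    consider "i \<le> a" "j \<le> b" | "a < i" | "b < j" by linarith
    then obtain i' j' where ij: "(i', j') \<in> ?B" "i' \<le> i" "j' \<le> j"
    proof cases
      case 1 then show ?thesis using that z by auto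
    next
      case 2 then show ?thesis using that[of a 0] assms by auto
    next
      case 3 then show ?thesis using that[of 0 b] assms by auto
    qed
    have "z = (real i' + (real i - real i' + s), real j' + (real j - real j' + t))"
      using z by simp
    moreover have "0 \<le> real i - real i' + s" "0 \<le> real j - real j' + t" using ij z by auto
    ultimately show "z \<in> (\<Union>(i, j) \<in> ?B. {(real i + s, real j + t) | s t. 0 \<le> s \<and> 0 \<le> t})"
      using ij(1) by blast
  qed blast
  also have "\<dots> = (\<Union>x\<in>convex hull (real_pt ` ?B). \<Union>y\<in>{0..} \<times> {0..}. {x + y})"
    unfolding newton_polyhedron_sum by blast
  also have "closed \<dots>"
    by (intro compact_closed_sums finite_imp_compact_convex_hull closed_Times closed_atLeast) auto
  finally show ?thesis .
qed

lemma newton_polyhedron_nonneg: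
  assumes "z \<in> newton_polyhedron S"
  shows "0 \<le> fst z" "0 \<le> snd z"
  using newton_polyhedron_bound[OF assms, of 1 0 0] newton_polyhedron_bound[OF assms, of 0 1 0] by auto

text \<open>Weight \<open>c + 1\<close> on a coordinate makes every support point off the
  corresponding axis irrelevant for values up to \<open>c\<close>. This supplies strictly positive
  functionals for points on the axes.\<close>

lemma weight_bound:
  fixes c d s :: real
  assumes "n \<noteq> 0" "0 \<le> c" "0 \<le> d" "s \<le> c"
  shows "s \<le> (c + 1) * real n + d"
proof -
  have "s \<le> (c + 1) * 1" using assms by simp
  also have "\<dots> \<le> (c + 1) * real n" using assms by (intro mult_left_mono) auto
  also have "\<dots> \<le> (c + 1) * real n + d" using assms by simp
  finally show ?thesis .
qed

text \<open>A point with positive coordinates is moved along its ray to the first point of the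
  polyhedron. A supporting functional there has positive weights because the support meets both
  axes. On an axis the supporting line could be the vertical or horizontal one, so there the weights
  are written down explicitly.\<close>

lemma below_diagram_eq_region:
  assumes ab: "(a, 0) \<in> S" "(0, b) \<in> S"
  shows "below_diagram S = region S"
proof (intro equalityI subsetI)
  have S: "S \<noteq> {}" using ab by auto
  let ?N = "newton_polyhedron S"
  fix z assume "z \<in> below_diagram S"
  then obtain x u where x: "x \<in> newton_diagram S" and u: "0 \<le> u" "u \<le> 1" "z = u *\<^sub>R x"
    by (auto simp: below_diagram_def in_segment)
  obtain p q where pq: "0 < p" "0 < q" "under p q S x" and N: "x \<in> ?N"
    using x by (auto simp: newton_diagram_iff[OF S])
  note nn = newton_polyhedron_nonneg[OF N]
  have "p * fst z + q * snd z = u * (p * fst x + q * snd x)" by (simp add: u algebra_simps)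
  also have "\<dots> \<le> p * fst x + q * snd x"
    using pq nn u by (intro mult_left_le_one_le) auto
  finally have "under p q S z" using pq(3) by (fastforce simp: under_def)
  then show "z \<in> region S" using pq nn u by (auto simp: region_def)
next
  have S: "S \<noteq> {}" using ab by auto
  let ?N = "newton_polyhedron S"
  fix z assume "z \<in> region S"
  then obtain p q where nn: "0 \<le> fst z" "0 \<le> snd z" and pq: "0 < p" "0 < q" "under p q S z"
    by (auto simp: region_def)
  have suff: "z \<in> below_diagram S"
    if "x \<in> ?N" "0 < p'" "0 < q'" "under p' q' S x" "0 \<le> u" "u \<le> 1" "z = u *\<^sub>R x" for x p' q' u
  proof -
    have "x \<in> newton_diagram S" using that by (auto simp: newton_diagram_iff[OF S])
    moreover have "z \<in> closed_segment 0 x" using that by (auto simp: in_segment)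
    ultimately show ?thesis by (auto simp: below_diagram_def)
  qed
  consider "fst z = 0" | "snd z = 0" | "0 < fst z" "0 < snd z" using nn by linarith
  then show "z \<in> below_diagram S"
  proof cases
    case 1
    define c where "c = (LEAST c. (0, c) \<in> S)"
    have c: "(0, c) \<in> S" unfolding c_def using ab(2) by (rule LeastI)
    have le: "c \<le> j" if "(0, j) \<in> S" for j unfolding c_def using that by (rule Least_le)
    have "q * snd z \<le> q * c" using underD[OF pq(3) c] 1 by simp
    then have zc: "snd z \<le> c" using pq by simp
    have "real c \<le> (real c + 1) * real i + 1 * real j" if "(i, j) \<in> S" for i j
    proof (cases "i = 0")
      case False
      then show ?thesis
        using weight_bound[of i "real c" "real j"] weight_bound[of j "real c" "real i"] by (auto simp: add.commute)
    qed (use le that in auto)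
    then have "under (real c + 1) 1 S (real_pt (0, c))"
      by (auto simp: under_def real_pt_def)
    moreover have "z = (snd z / c) *\<^sub>R real_pt (0, c)"
      using 1 zc nn by (cases "c = 0") (auto simp: real_pt_def prod_eq_iff)
    ultimately show ?thesis
      using suff[OF real_pt_in_newton_polyhedron[OF c], of "real c + 1" 1 "snd z / c"] zc nn
      by (auto simp: divide_le_eq_1)
  next
    case 2
    define c where "c = (LEAST c. (c, 0) \<in> S)"
    have c: "(c, 0) \<in> S" unfolding c_def using ab(1) by (rule LeastI)
    have le: "c \<le> j" if "(j, 0) \<in> S" for j unfolding c_def using that by (rule Least_le)
    have "p * fst z \<le> p * c" using underD[OF pq(3) c] 2 by simp
    then have zc: "fst z \<le> c" using pq by simp
    have "real c \<le> 1 * real i + (real c + 1) * real j" if "(i, j) \<in> S" for i j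
    proof (cases "j = 0")
      case False
      then show ?thesis
        using weight_bound[of i "real c" "real j"] weight_bound[of j "real c" "real i"] by (auto simp: add.commute)
    qed (use le that in auto)
    then have "under 1 (real c + 1) S (real_pt (c, 0))"
      by (auto simp: under_def real_pt_def)
    moreover have "z = (fst z / c) *\<^sub>R real_pt (c, 0)"
      using 2 zc nn by (cases "c = 0") (auto simp: real_pt_def prod_eq_iff)
    ultimately show ?thesis
      using suff[OF real_pt_in_newton_polyhedron[OF c], of 1 "real c + 1" "fst z / c"] zc nn
      by (auto simp: divide_le_eq_1)
  next
    case 3
    define L where "L = {l. l *\<^sub>R z \<in> ?N}"
    have "closed (?N :: (real \<times> real) set)" using closed_newton_polyhedron[OF ab] .
    then have "closed L"
      unfolding L_def using continuous_closed_vimage[of ?N "\<lambda>l. l *\<^sub>R z"] by (auto simp: vimage_def)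
    have L0: "0 \<le> l" if "l \<in> L" for l
      using newton_polyhedron_nonneg(1)[of "l *\<^sub>R z"] that 3 by (auto simp: L_def zero_le_mult_iff)
    have "(real a / fst z) *\<^sub>R z = real_pt (a, 0) + (0, real a / fst z * snd z)"
      using 3 by (simp add: real_pt_def prod_eq_iff)
    then have "real a / fst z \<in> L"
      using newton_polyhedron_upward[OF real_pt_in_newton_polyhedron[OF ab(1)], of 0 "real a / fst z * snd z"] 3
      by (simp add: L_def)
    then have Lne: "L \<noteq> {}" by blast
    have bdd: "bdd_below L" using L0 unfolding bdd_below_def by blast
    define l where "l = Inf L"
    have lL: "l \<in> L" unfolding l_def using closed_contains_Inf[OF Lne bdd \<open>closed L\<close>] .
    have lmin: "l \<le> r" if "r \<in> L" for r unfolding l_def using cInf_lower[OF that bdd] .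
    define x where "x = l *\<^sub>R z"
    have xN: "x \<in> ?N" using lL by (simp add: L_def x_def)
    have "p * fst z + q * snd z \<le> p * fst x + q * snd x"
      using pq xN by (simp add: under_iff_newton_polyhedron)
    also have "\<dots> = l * (p * fst z + q * snd z)" by (simp add: x_def algebra_simps)
    finally have l1: "1 \<le> l" using pq 3 by (simp add: mult_le_cancel_right1 add_pos_pos)
    have xpos: "0 < fst x" "0 < snd x" using l1 3 by (auto simp: x_def)
    have "x \<notin> rel_interior ?N"
    proof
      assume xr: "x \<in> rel_interior ?N"
      \<comment> \<open>The segment from 2x to \<open>x\<close> could be prolonged past
        \<open>x\<close> inside the polyhedron, giving a scaling smaller than the least one.\<close>
      have "x + (fst x, snd x) \<in> ?N"
        using newton_polyhedron_upward[OF xN, of "fst x" "snd x"] xpos by simp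
      then obtain e where e: "1 < e" "(1 - e) *\<^sub>R (x + x) + e *\<^sub>R x \<in> ?N"
        using xr convex_rel_interior_iff[OF convex_newton_polyhedron, of S x] xN by auto
      have "(1 - e) *\<^sub>R (x + x) + e *\<^sub>R x = ((2 - e) * l) *\<^sub>R z"
        by (simp add: x_def prod_eq_iff algebra_simps)
      then have "l \<le> (2 - e) * l" using lmin e by (simp add: L_def)
      then show False using e l1 by (simp add: mult_le_cancel_right1)
    qed
    then obtain v where v: "v \<noteq> 0" "\<And>y. y \<in> ?N \<Longrightarrow> v \<bullet> x \<le> v \<bullet> y"
      by (rule supporting_hyperplane_rel_boundary[OF convex_newton_polyhedron xN]) (rule that)
    obtain p' q' where v': "v = (p', q')" by (cases v)
    have le: "p' * fst x + q' * snd x \<le> p' * fst y + q' * snd y" if "y \<in> ?N" for y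
      using v(2)[OF that] by (simp add: v' inner_prod_def)
    have p0: "0 \<le> p'" using le[OF newton_polyhedron_upward[OF xN, of 1 0]] by (simp add: algebra_simps)
    have q0: "0 \<le> q'" using le[OF newton_polyhedron_upward[OF xN, of 0 1]] by (simp add: algebra_simps)
    \<comment> \<open>With weight zero here, the support point (a, 0) would have value 0, below the
      positive value of \<open>x\<close>.\<close>
    have "p' \<noteq> 0"
    proof
      assume "p' = 0"
      then have "0 < q'" using q0 v(1) v' by (auto simp: zero_prod_def)
      then have "0 < q' * snd x" using xpos by simp
      then show False
        using le[OF real_pt_in_newton_polyhedron[OF ab(1)]] unfolding \<open>p' = 0\<close> real_pt_def by simp
    qed
    moreover have "q' \<noteq> 0"
    proof
      assume "q' = 0"
      then have "0 < p'" using p0 v(1) v' by (auto simp: zero_prod_def)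
      then have "0 < p' * fst x" using xpos by simp
      then show False
        using le[OF real_pt_in_newton_polyhedron[OF ab(2)]] unfolding \<open>q' = 0\<close> real_pt_def by simp
    qed
    ultimately have "0 < p'" "0 < q'" using p0 q0 by auto
    moreover have "under p' q' S x"
      using le p0 q0 by (simp add: under_iff_newton_polyhedron)
    moreover have "z = (1 / l) *\<^sub>R x" using l1 by (simp add: x_def)
    ultimately show ?thesis using suff[OF xN, of p' q' "1 / l"] l1 by simp
  qed
qed

section \<open>Axis intercepts and the Newton number in terms of the region\<close>

definition x_intercept :: "(nat \<times> nat) set \<Rightarrow> nat" where
  "x_intercept S = (LEAST a. (a, 0) \<in> S)"

definition y_intercept :: "(nat \<times> nat) set \<Rightarrow> nat" where
  "y_intercept S = (LEAST b. (0, b) \<in> S)"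

lemma x_intercept: "(a, 0) \<in> S \<Longrightarrow> (x_intercept S, 0) \<in> S" "(a, 0) \<in> S \<Longrightarrow> x_intercept S \<le> a"
  unfolding x_intercept_def by (auto intro: LeastI Least_le)

lemma y_intercept: "(0, b) \<in> S \<Longrightarrow> (0, y_intercept S) \<in> S" "(0, b) \<in> S \<Longrightarrow> y_intercept S \<le> b"
  unfolding y_intercept_def by (auto intro: LeastI Least_le)

lemma region_x_axis:
  assumes "(a, 0) \<in> S"
  shows "{s. (s, 0) \<in> region S} = {0..real (x_intercept S)}"
proof (intro equalityI subsetI)
  let ?c = "real (x_intercept S)"
  fix s assume "s \<in> {s. (s, 0) \<in> region S}"
  then obtain p q where "0 \<le> s" "0 < p" "0 < q" "under p q S (s, 0)" by (auto simp: region_def)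
  then show "s \<in> {0..?c}" using underD[OF _ x_intercept(1)[OF assms], of p q "(s, 0)"] by auto
next
  let ?c = "real (x_intercept S)"
  fix s assume s: "s \<in> {0..?c}"
  have "s \<le> 1 * real i + (?c + 1) * real j" if "(i, j) \<in> S" for i j
  proof (cases "j = 0")
    case False
    then show ?thesis
      using weight_bound[of i ?c "real j"] weight_bound[of j ?c "real i"] s by (auto simp: add.commute)
  qed (use x_intercept(2) that s in fastforce)
  then have "under 1 (?c + 1) S (s, 0)" by (auto simp: under_def)
  then show "s \<in> {s. (s, 0) \<in> region S}" using s by (auto intro!: regionI)
qed

lemma region_y_axis:
  assumes "(0, b) \<in> S"
  shows "{t. (0, t) \<in> region S} = {0..real (y_intercept S)}"
proof (intro equalityI subsetI)
  let ?c = "real (y_intercept S)"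
  fix t assume "t \<in> {t. (0, t) \<in> region S}"
  then obtain p q where "0 \<le> t" "0 < p" "0 < q" "under p q S (0, t)" by (auto simp: region_def)
  then show "t \<in> {0..?c}" using underD[OF _ y_intercept(1)[OF assms], of p q "(0, t)"] by auto
next
  let ?c = "real (y_intercept S)"
  fix t assume t: "t \<in> {0..?c}"
  have "t \<le> (?c + 1) * real i + 1 * real j" if "(i, j) \<in> S" for i j
  proof (cases "i = 0")
    case False
    then show ?thesis
      using weight_bound[of i ?c "real j"] weight_bound[of j ?c "real i"] t by (auto simp: add.commute)
  qed (use y_intercept(2) that t in fastforce)
  then have "under (?c + 1) 1 S (0, t)" by (auto simp: under_def)
  then show "t \<in> {t. (0, t) \<in> region S}" using t by (auto intro!: regionI)
qed

lemma newton_number_eq: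
  assumes "(a, 0) \<in> S" "(0, b) \<in> S"
  shows "newton_number S = measure lborel (region S)
    - (real (x_intercept S) + real (y_intercept S)) / 2 + (\<Sum>F\<in>newton_facets S. lattice_length F) / 2"
  unfolding newton_number_def V1_def V2_def below_diagram_eq_region[OF assms]
    region_x_axis[OF assms(1)] region_y_axis[OF assms(2)] by simp

section \<open>Blowing up Newton diagrams\<close>

definition blow_x :: "nat \<Rightarrow> (nat \<times> nat) set \<Rightarrow> (nat \<times> nat) set" where
  "blow_x m S = (\<lambda>(i, j). (i + j - m, j)) ` S"

definition blow_y :: "nat \<Rightarrow> (nat \<times> nat) set \<Rightarrow> (nat \<times> nat) set" where
  "blow_y m S = (\<lambda>(i, j). (i, i + j - m)) ` S"

definition shear_x :: "real \<Rightarrow> real \<times> real \<Rightarrow> real \<times> real" where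
  "shear_x c z = (fst z + snd z - c, snd z)"

definition shear_y :: "real \<Rightarrow> real \<times> real \<Rightarrow> real \<times> real" where
  "shear_y c z = (fst z, fst z + snd z - c)"

text \<open>Points on the diagram itself count. By Pick's theorem this is why the lattice lengths
  enter the Newton number with sign +1/2 and the axis lengths with sign -1/2.\<close>

definition inner_points :: "(nat \<times> nat) set \<Rightarrow> (nat \<times> nat) set" where
  "inner_points S = {(i, j). 1 \<le> i \<and> 1 \<le> j \<and> real_pt (i, j) \<in> region S}"

lemma under_scale: "0 < c \<Longrightarrow> under (c * p) (c * q) S z \<longleftrightarrow> under p q S z"
  by (simp add: under_def mult.assoc distrib_left[symmetric])

lemma under_add: "under p q S z \<Longrightarrow> under p' q' S z \<Longrightarrow> under (p + p') (q + q') S z"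
  by (fastforce simp: under_def algebra_simps)

text \<open>Here \<open>m\<close> is the order of the support; the lower bound makes the natural
  number subtractions in \<open>blow_x\<close> and \<open>blow_y\<close> exact.\<close>

locale newton_blow_up =
  fixes S :: "(nat \<times> nat) set" and m :: nat
  assumes order_le: "(i, j) \<in> S \<Longrightarrow> m \<le> i + j"
    and order_attained: "\<exists>i j. (i, j) \<in> S \<and> i + j = m"
begin

lemma nonempty: "S \<noteq> {}"
  using order_attained by auto

text \<open>p (i + j - m) + q j = p i + (p + q) j - p m, and the constant p m cancels on both
  sides.\<close>

lemma under_shear_x: "under p q (blow_x m S) (shear_x m z) \<longleftrightarrow> under p (p + q) S z"
  unfolding under_def blow_x_def shear_x_def ball_simps
  by (intro ball_cong refl) (auto simp: of_nat_diff order_le algebra_simps)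

lemma under_shear_y: "under p q (blow_y m S) (shear_y m z) \<longleftrightarrow> under (p + q) q S z"
  unfolding under_def blow_y_def shear_y_def ball_simps
  by (intro ball_cong refl) (auto simp: of_nat_diff order_le algebra_simps)

lemma under_diagonal:
  assumes "0 < p"
  shows "under p p S z \<longleftrightarrow> fst z + snd z \<le> real m"
proof
  obtain i j where ij: "(i, j) \<in> S" "i + j = m" using order_attained by blast
  assume "under p p S z"
  then have "p * (fst z + snd z) \<le> p * (real i + real j)"
    using underD ij by (fastforce simp: distrib_left)
  then show "fst z + snd z \<le> real m" using assms ij by auto
next
  assume le: "fst z + snd z \<le> real m"
  have "p * (fst z + snd z) \<le> p * (real i + real j)" if "(i, j) \<in> S" for i j
    using order_le[OF that] le assms by (intro mult_left_mono) auto
  then show "under p p S z" by (auto simp: under_def distrib_left)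
qed

text \<open>The terms of lowest degree land on the exceptional axis, at height at most
  \<open>m\<close>. So each transformed diagram meets its exceptional axis, whatever
  \<open>S\<close> is.\<close>

lemma y_intercept_blow_x: "(0, y_intercept (blow_x m S)) \<in> blow_x m S"
  and y_intercept_blow_x_le: "y_intercept (blow_x m S) \<le> m"
proof -
  obtain i j where ij: "(i, j) \<in> S" "i + j = m" using order_attained by blast
  then have *: "(0, j) \<in> blow_x m S" by (force simp: blow_x_def)
  then show "(0, y_intercept (blow_x m S)) \<in> blow_x m S" by (rule y_intercept)
  show "y_intercept (blow_x m S) \<le> m" using y_intercept(2)[OF *] ij by linarith
qed

lemma x_intercept_blow_y: "(x_intercept (blow_y m S), 0) \<in> blow_y m S"
  and x_intercept_blow_y_le: "x_intercept (blow_y m S) \<le> m"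
proof -
  obtain i j where ij: "(i, j) \<in> S" "i + j = m" using order_attained by blast
  then have *: "(i, 0) \<in> blow_y m S" by (force simp: blow_y_def)
  then show "(x_intercept (blow_y m S), 0) \<in> blow_y m S" by (rule x_intercept)
  show "x_intercept (blow_y m S) \<le> m" using x_intercept(2)[OF *] ij by linarith
qed

lemma region_low: "0 \<le> fst z \<Longrightarrow> 0 \<le> snd z \<Longrightarrow> fst z + snd z \<le> real m \<Longrightarrow> z \<in> region S"
  by (rule regionI[of 1 1]) (simp_all add: under_diagonal)

lemma region_high:
  assumes "z \<in> region S" "real m < fst z + snd z"
  shows "shear_x m z \<in> region (blow_x m S) \<or> shear_y m z \<in> region (blow_y m S)"
proof -
  obtain p q where nn: "0 \<le> fst z" "0 \<le> snd z" and pq: "0 < p" "0 < q" "under p q S z"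
    using assms(1) by (auto simp: region_def)
  consider "p < q" | "q < p" | "p = q" by linarith
  then show ?thesis
  proof cases
    case 1
    then have "under p (q - p) (blow_x m S) (shear_x m z)" using pq by (simp add: under_shear_x)
    moreover have "0 < q - p" using 1 by simp
    ultimately have "shear_x m z \<in> region (blow_x m S)"
      using pq nn assms(2) by (intro regionI[of p "q - p"]) (auto simp: shear_x_def)
    then show ?thesis ..
  next
    case 2
    then have "under (p - q) q (blow_y m S) (shear_y m z)" using pq by (simp add: under_shear_y)
    moreover have "0 < p - q" using 2 by simp
    ultimately have "shear_y m z \<in> region (blow_y m S)"
      using pq nn assms(2) by (intro regionI[of "p - q" q]) (auto simp: shear_y_def)
    then show ?thesis ..
  next
    case 3
    then show ?thesis using pq assms(2) under_diagonal[of p z] by simp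
  qed
qed

text \<open>
  A point above the antidiagonal cannot have witnesses on both sides: a positive combination of the
  two functionals is a multiple of \<open>s + t\<close>.
\<close>

lemma region_exclusive:
  assumes "shear_x m z \<in> region (blow_x m S)" "shear_y m z \<in> region (blow_y m S)"
  shows "fst z + snd z \<le> real m"
proof -
  obtain p q where pq: "0 < p" "0 < q" "under p (p + q) S z"
    using assms(1) by (auto simp: region_def under_shear_x)
  obtain p' q' where pq': "0 < p'" "0 < q'" "under (p' + q') q' S z"
    using assms(2) by (auto simp: region_def under_shear_y)
  \<comment> \<open>The multipliers \<open>p'\<close> and \<open>q\<close> make the two weights of
    the combination equal: both are p p' + q p' + q q'.\<close>
  have "under (p' * p + q * (p' + q')) (p' * (p + q) + q * q') S z"
    using pq pq' by (intro under_add) (simp_all add: under_scale)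
  moreover have "p' * p + q * (p' + q') = p' * (p + q) + q * q'" by (simp add: algebra_simps)
  moreover have "0 < p' * (p + q) + q * q'" using pq pq' by (simp add: add_pos_pos)
  ultimately show ?thesis by (simp add: under_diagonal)
qed

text \<open>The issue is that undoing the shear might leave the quadrant. Off the exceptional axis
  the second coordinate stays below the intercept, hence below \<open>m\<close>, while the
  coordinates of \<open>z\<close> add up to more than \<open>m\<close>.\<close>

lemma region_blow_x:
  assumes z: "shear_x m z \<in> region (blow_x m S)" "real m < fst z + snd z"
  shows "z \<in> region S"
proof -
  obtain p q where pq: "0 < p" "0 < q" "under p (p + q) S z" and nn: "0 \<le> snd z"
    and u: "under p q (blow_x m S) (shear_x m z)"
    using z(1) by (auto simp: region_def under_shear_x[symmetric] shear_x_def)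
  have "p * (fst z + snd z - m) + q * snd z \<le> q * y_intercept (blow_x m S)"
    using underD[OF u y_intercept_blow_x] by (simp add: shear_x_def)
  moreover have "0 < p * (fst z + snd z - m)" using pq z by simp
  ultimately have "q * snd z < q * y_intercept (blow_x m S)" by linarith
  then have "snd z < y_intercept (blow_x m S)" using pq by simp
  then have "0 < fst z" using y_intercept_blow_x_le z(2) by linarith
  moreover have "0 < p + q" using pq by simp
  ultimately show "z \<in> region S" using nn pq by (intro regionI[of p "p + q"]) auto
qed

lemma region_blow_y:
  assumes z: "shear_y m z \<in> region (blow_y m S)" "real m < fst z + snd z"
  shows "z \<in> region S"
proof -
  obtain p q where pq: "0 < p" "0 < q" "under (p + q) q S z" and nn: "0 \<le> fst z"
    and u: "under p q (blow_y m S) (shear_y m z)"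
    using z(1) by (auto simp: region_def under_shear_y[symmetric] shear_y_def)
  have "p * fst z + q * (fst z + snd z - m) \<le> p * x_intercept (blow_y m S)"
    using underD[OF u x_intercept_blow_y] by (simp add: shear_y_def)
  moreover have "0 < q * (fst z + snd z - m)" using pq z by simp
  ultimately have "p * fst z < p * x_intercept (blow_y m S)" by linarith
  then have "fst z < x_intercept (blow_y m S)" using pq by simp
  then have "0 < snd z" using x_intercept_blow_y_le z(2) by linarith
  moreover have "0 < p + q" using pq by simp
  ultimately show "z \<in> region S" using nn pq by (intro regionI[of "p + q" q]) auto
qed

definition low_region :: "(real \<times> real) set" where
  "low_region = {z. 0 \<le> fst z \<and> 0 \<le> snd z \<and> fst z + snd z \<le> real m}"

text \<open>The strict inequality drops the exceptional axis, whose points already belong to the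
  triangle.\<close>

definition right_region :: "(real \<times> real) set" where
  "right_region = {z. real m < fst z + snd z \<and> shear_x m z \<in> region (blow_x m S)}"

definition left_region :: "(real \<times> real) set" where
  "left_region = {z. real m < fst z + snd z \<and> shear_y m z \<in> region (blow_y m S)}"

lemma region_decomp: "region S = low_region \<union> right_region \<union> left_region"
proof (rule set_eqI)
  fix z
  have "z \<in> region S \<Longrightarrow> 0 \<le> fst z \<and> 0 \<le> snd z" by (auto simp: region_def)
  then show "z \<in> region S \<longleftrightarrow> z \<in> low_region \<union> right_region \<union> left_region"
    using region_low[of z] region_high[of z] region_blow_x[of z] region_blow_y[of z]
    unfolding low_region_def right_region_def left_region_def Un_iff mem_Collect_eq not_le[symmetric]
    by blast
qed

lemma region_disjoint:
  "low_region \<inter> right_region = {}" "low_region \<inter> left_region = {}" "right_region \<inter> left_region = {}"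
  unfolding low_region_def right_region_def left_region_def
  by (auto dest: region_exclusive)

text \<open>In the x-chart a positive first coordinate means exactly i + j > m, so positivity in
  each chart matches the strict inequality that separates its piece from the triangle.\<close>

lemma inner_points_decomp:
  defines "L \<equiv> {(i, j). 1 \<le> i \<and> 1 \<le> j \<and> i + j \<le> m}"
    and "X \<equiv> (\<lambda>(i, j). (i + m - j, j)) ` inner_points (blow_x m S)"
    and "Y \<equiv> (\<lambda>(i, j). (i, j + m - i)) ` inner_points (blow_y m S)"
  shows "inner_points S = L \<union> X \<union> Y"
    and "L \<inter> X = {}" "L \<inter> Y = {}" "X \<inter> Y = {}"
    and "inj_on (\<lambda>(i, j). (i + m - j, j)) (inner_points (blow_x m S))"
    and "inj_on (\<lambda>(i, j). (i, j + m - i)) (inner_points (blow_y m S))"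
proof -
  have L: "(i, j) \<in> L \<longleftrightarrow> 1 \<le> i \<and> 1 \<le> j \<and> real_pt (i, j) \<in> low_region" for i j
    by (auto simp: L_def low_region_def real_pt_def)
  \<comment> \<open>Being strictly off the exceptional axis forces \<open>j\<close> below the
    intercept; this makes the subtraction in i + m - j exact. \<open>ltY\<close> is the mirror
    image.\<close>
  have ltX: "j < m" if mem: "(i, j) \<in> inner_points (blow_x m S)" for i j
  proof -
    obtain p q where pq: "0 < p" "0 < q" "under p q (blow_x m S) (real_pt (i, j))" and i: "1 \<le> i"
      using mem by (auto simp: inner_points_def region_def)
    have "p * real i + q * real j \<le> q * y_intercept (blow_x m S)"
      using underD[OF pq(3) y_intercept_blow_x] by (simp add: real_pt_def)
    moreover have "0 < p * real i" using pq i by simp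
    ultimately have "q * real j < q * y_intercept (blow_x m S)" by linarith
    then show ?thesis using pq y_intercept_blow_x_le by simp
  qed
  have ltY: "i < m" if mem: "(i, j) \<in> inner_points (blow_y m S)" for i j
  proof -
    obtain p q where pq: "0 < p" "0 < q" "under p q (blow_y m S) (real_pt (i, j))" and j: "1 \<le> j"
      using mem by (auto simp: inner_points_def region_def)
    have "p * real i + q * real j \<le> p * x_intercept (blow_y m S)"
      using underD[OF pq(3) x_intercept_blow_y] by (simp add: real_pt_def)
    moreover have "0 < q * real j" using pq j by simp
    ultimately have "p * real i < p * x_intercept (blow_y m S)" by linarith
    then show ?thesis using pq x_intercept_blow_y_le by simp
  qed
  have X: "(i, j) \<in> X \<longleftrightarrow> 1 \<le> i \<and> 1 \<le> j \<and> real_pt (i, j) \<in> right_region" for i j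
  proof
    assume "(i, j) \<in> X"
    then obtain i' where i': "(i', j) \<in> inner_points (blow_x m S)" "i = i' + m - j" by (auto simp: X_def)
    have "shear_x m (real_pt (i, j)) = real_pt (i', j)"
      using ltX[OF i'(1)] i'(2) by (simp add: shear_x_def real_pt_def of_nat_diff)
    then show "1 \<le> i \<and> 1 \<le> j \<and> real_pt (i, j) \<in> right_region"
      using i' ltX[OF i'(1)] by (auto simp: right_region_def inner_points_def real_pt_def)
  next
    assume *: "1 \<le> i \<and> 1 \<le> j \<and> real_pt (i, j) \<in> right_region"
    then have m: "m < i + j" by (auto simp: right_region_def real_pt_def)
    then have "shear_x m (real_pt (i, j)) = real_pt (i + j - m, j)"
      by (simp add: shear_x_def real_pt_def of_nat_diff)
    then have "(i + j - m, j) \<in> inner_points (blow_x m S)"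
      using * m by (auto simp: right_region_def inner_points_def)
    moreover have "(i, j) = (\<lambda>(i, j). (i + m - j, j)) (i + j - m, j)" using m by simp
    ultimately show "(i, j) \<in> X" unfolding X_def by (rule rev_image_eqI)
  qed
  have Y: "(i, j) \<in> Y \<longleftrightarrow> 1 \<le> i \<and> 1 \<le> j \<and> real_pt (i, j) \<in> left_region" for i j
  proof
    assume "(i, j) \<in> Y"
    then obtain j' where j': "(i, j') \<in> inner_points (blow_y m S)" "j = j' + m - i" by (auto simp: Y_def)
    have "shear_y m (real_pt (i, j)) = real_pt (i, j')"
      using ltY[OF j'(1)] j'(2) by (simp add: shear_y_def real_pt_def of_nat_diff)
    then show "1 \<le> i \<and> 1 \<le> j \<and> real_pt (i, j) \<in> left_region"
      using j' ltY[OF j'(1)] by (auto simp: left_region_def inner_points_def real_pt_def)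
  next
    assume *: "1 \<le> i \<and> 1 \<le> j \<and> real_pt (i, j) \<in> left_region"
    then have m: "m < i + j" by (auto simp: left_region_def real_pt_def)
    then have "shear_y m (real_pt (i, j)) = real_pt (i, i + j - m)"
      by (simp add: shear_y_def real_pt_def of_nat_diff)
    then have "(i, i + j - m) \<in> inner_points (blow_y m S)"
      using * m by (auto simp: left_region_def inner_points_def)
    moreover have "(i, j) = (\<lambda>(i, j). (i, j + m - i)) (i, i + j - m)" using m by simp
    ultimately show "(i, j) \<in> Y" unfolding Y_def by (rule rev_image_eqI)
  qed
  have LXY: "L = {z \<in> {1..} \<times> {1..}. real_pt z \<in> low_region}"
    "X = {z \<in> {1..} \<times> {1..}. real_pt z \<in> right_region}"
    "Y = {z \<in> {1..} \<times> {1..}. real_pt z \<in> left_region}"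
    using L X Y by auto
  show "inner_points S = L \<union> X \<union> Y"
    unfolding LXY inner_points_def region_decomp by auto
  show "L \<inter> X = {}" "L \<inter> Y = {}" "X \<inter> Y = {}"
    unfolding LXY using region_disjoint by auto
  show "inj_on (\<lambda>(i, j). (i + m - j, j)) (inner_points (blow_x m S))"
    by (auto simp: inj_on_def dest!: ltX)
  show "inj_on (\<lambda>(i, j). (i, j + m - i)) (inner_points (blow_y m S))"
    by (auto simp: inj_on_def dest!: ltY)
qed

lemma card_low_points:
  "finite {(i, j). 1 \<le> i \<and> 1 \<le> j \<and> i + j \<le> m}"
  "card {(i, j). 1 \<le> i \<and> 1 \<le> j \<and> i + j \<le> m} = m * (m - 1) div 2"
proof -
  have eq: "{(i, j). 1 \<le> i \<and> 1 \<le> j \<and> i + j \<le> m} = (SIGMA i:{1..<m}. {1..m - i})" by auto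
  show "finite {(i, j). 1 \<le> i \<and> 1 \<le> j \<and> i + j \<le> m}" unfolding eq by simp
  have "card (SIGMA i:{1..<m}. {1..m - i}) = (\<Sum>i\<in>{1..<m}. m - i)" by simp
  also have "\<dots> = (\<Sum>i\<in>{1..<m}. i)"
    by (rule sum.reindex_bij_witness[of _ "\<lambda>i. m - i" "\<lambda>i. m - i"]) auto
  also have "\<dots> = \<Sum>{0..<m}"
    by (rule sum.mono_neutral_left) auto
  also have "\<dots> = m * (m - 1) div 2"
    by (simp add: Sum_Ico_nat)
  finally show "card {(i, j). 1 \<le> i \<and> 1 \<le> j \<and> i + j \<le> m} = m * (m - 1) div 2" unfolding eq .
qed

lemma finite_inner_points_iff:
  "finite (inner_points S) \<longleftrightarrow> finite (inner_points (blow_x m S)) \<and> finite (inner_points (blow_y m S))"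
  unfolding inner_points_decomp(1) finite_Un
  using card_low_points(1) finite_image_iff[OF inner_points_decomp(5)] finite_image_iff[OF inner_points_decomp(6)]
  by simp

lemma card_inner_points:
  assumes "finite (inner_points S)"
  shows "card (inner_points S)
    = m * (m - 1) div 2 + card (inner_points (blow_x m S)) + card (inner_points (blow_y m S))"
  using assms unfolding finite_inner_points_iff
  by (simp add: inner_points_decomp(1) card_Un_disjoint inner_points_decomp(2-4) Int_Un_distrib2
      card_low_points card_image inner_points_decomp(5,6) del: One_nat_def)

end

section \<open>Areas\<close>

lemma borel_shear:
  assumes "A \<in> sets borel"
  shows "shear_x c -` A \<in> sets borel" "shear_y c -` A \<in> sets borel"
proof -
  have "shear_x c \<in> borel_measurable borel" "shear_y c \<in> borel_measurable borel"
    unfolding shear_x_def[abs_def] shear_y_def[abs_def]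
    by (intro borel_measurable_continuous_onI continuous_intros)+
  then show "shear_x c -` A \<in> sets borel" "shear_y c -` A \<in> sets borel"
    using assms by (simp_all add: measurable_sets_borel)
qed

lemma emeasure_lborel_translate:
  fixes B :: "real set"
  assumes "B \<in> sets borel"
  shows "emeasure lborel ((\<lambda>x. c + x) -` B) = emeasure lborel B"
proof -
  have "emeasure lborel B = emeasure (distr lborel borel ((+) c)) B" by (simp add: lborel_distr_plus)
  also have "\<dots> = emeasure lborel ((\<lambda>x. c + x) -` B)" using assms by (subst emeasure_distr) auto
  finally show ?thesis ..
qed

text \<open>A shear translates each slice parallel to its direction, so Tonelli's theorem applies
  slice by slice.\<close>

lemma emeasure_shear:
  assumes A: "A \<in> sets borel"
  shows "emeasure lborel (shear_x c -` A) = emeasure lborel A"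
    and "emeasure lborel (shear_y c -` A) = emeasure lborel A"
proof -
  have lb: "lborel = (lborel \<Otimes>\<^sub>M lborel :: (real \<times> real) measure)" by (rule lborel_prod[symmetric])
  have sets: "B \<in> sets borel \<Longrightarrow> B \<in> sets (lborel \<Otimes>\<^sub>M lborel)" for B :: "(real \<times> real) set"
    by (metis lborel_prod sets_lborel)
  have "emeasure lborel ((\<lambda>x. (x, y)) -` (shear_x c -` A)) = emeasure lborel ((\<lambda>x. (x, y)) -` A)" for y
  proof -
    have "(\<lambda>x. (x, y)) -` (shear_x c -` A) = (\<lambda>x. (y - c) + x) -` ((\<lambda>x. (x, y)) -` A)"
      by (auto simp: shear_x_def algebra_simps)
    moreover have "(\<lambda>x. (x, y)) -` A \<in> sets borel" using sets_Pair2[OF sets[OF A]] by simp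
    ultimately show ?thesis by (simp add: emeasure_lborel_translate)
  qed
  then show "emeasure lborel (shear_x c -` A) = emeasure lborel A"
    unfolding lb lborel_pair.emeasure_pair_measure_alt2[OF sets[OF A]]
      lborel_pair.emeasure_pair_measure_alt2[OF sets[OF borel_shear(1)[OF A]]] by simp
  have "emeasure lborel (Pair x -` (shear_y c -` A)) = emeasure lborel (Pair x -` A)" for x
  proof -
    have "Pair x -` (shear_y c -` A) = (\<lambda>y. (x - c) + y) -` (Pair x -` A)"
      by (auto simp: shear_y_def algebra_simps)
    moreover have "Pair x -` A \<in> sets borel" using sets_Pair1[OF sets[OF A]] by simp
    ultimately show ?thesis by (simp add: emeasure_lborel_translate)
  qed
  then show "emeasure lborel (shear_y c -` A) = emeasure lborel A"
    unfolding lb lborel.emeasure_pair_measure_alt[OF sets[OF A]]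
      lborel.emeasure_pair_measure_alt[OF sets[OF borel_shear(2)[OF A]]] by simp
qed

lemma negligible_axes:
  "emeasure lborel {z :: real \<times> real. fst z = 0} = 0" "emeasure lborel {z :: real \<times> real. snd z = 0} = 0"
proof -
  have "{z :: real \<times> real. fst z = 0} = {z. (1, 0) \<bullet> z = 0}"
    "{z :: real \<times> real. snd z = 0} = {z. (0, 1) \<bullet> z = 0}"
    by (auto simp: inner_prod_def)
  moreover have "{z :: real \<times> real. (1, 0) \<bullet> z = 0} \<in> null_sets lborel"
    "{z :: real \<times> real. (0, 1) \<bullet> z = 0} \<in> null_sets lborel"
    using negligible_hyperplane[of "(1, 0) :: real \<times> real" 0] negligible_hyperplane[of "(0, 1) :: real \<times> real" 0]
    by (auto simp: negligible_iff_null_sets null_sets_completion_iff closed_hyperplane borel_closed zero_prod_def)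
  ultimately show "emeasure lborel {z :: real \<times> real. fst z = 0} = 0"
    "emeasure lborel {z :: real \<times> real. snd z = 0} = 0"
    by auto
qed

lemma emeasure_diff_null:
  assumes "A \<in> sets borel" "N \<in> sets borel" "emeasure lborel N = 0"
  shows "emeasure lborel (A - N) = emeasure lborel A"
  using assms by (intro emeasure_Diff_null_set) (auto simp: null_sets_def)

lemma borel_line_sets:
  "{z :: real \<times> real. fst z = c} \<in> sets borel" "{z :: real \<times> real. snd z = c} \<in> sets borel"
  by (auto intro!: borel_closed closed_Collect_eq continuous_intros)

context newton_blow_up
begin

lemma low_region_borel: "low_region \<in> sets borel"
  unfolding low_region_def
  by (intro borel_closed closed_Collect_conj closed_Collect_le continuous_intros)

lemma emeasure_low_region: "emeasure lborel low_region = ennreal ((real m)\<^sup>2 / 2)"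
proof -
  have sets: "low_region \<in> sets (lborel \<Otimes>\<^sub>M lborel)"
    using low_region_borel by (metis lborel_prod sets_lborel)
  have "emeasure lborel low_region = (\<integral>\<^sup>+x. emeasure lborel (Pair x -` low_region) \<partial>lborel)"
    using lborel.emeasure_pair_measure_alt[OF sets] by (simp add: lborel_prod)
  also have "\<dots> = (\<integral>\<^sup>+x. ennreal (real m - x) * indicator {0..real m} x \<partial>lborel)"
  proof (rule nn_integral_cong)
    fix x :: real
    have "Pair x -` low_region = (if 0 \<le> x then {0..real m - x} else {})"
      by (auto simp: low_region_def)
    then show "emeasure lborel (Pair x -` low_region) = ennreal (real m - x) * indicator {0..real m} x"
      by (auto simp: indicator_def)
  qed
  also have "\<dots> = ennreal ((\<lambda>x. real m * x - x\<^sup>2 / 2) (real m) - (\<lambda>x. real m * x - x\<^sup>2 / 2) 0)"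
    by (intro nn_integral_FTC_Icc) (auto intro!: derivative_eq_intros)
  also have "\<dots> = ennreal ((real m)\<^sup>2 / 2)" by (simp add: power2_eq_square)
  finally show ?thesis .
qed

text \<open>Measurability is passed on together with the area, so that one induction delivers
  both.\<close>

lemma emeasure_region_blow_up:
  assumes bx: "region (blow_x m S) \<in> sets borel" and bY: "region (blow_y m S) \<in> sets borel"
  shows "region S \<in> sets borel"
    and "emeasure lborel (region S) = ennreal ((real m)\<^sup>2 / 2)
      + emeasure lborel (region (blow_x m S)) + emeasure lborel (region (blow_y m S))"
proof -
  \<comment> \<open>Above the antidiagonal means off the exceptional axis, and removing that axis
    costs no area.\<close>
  have R: "right_region = shear_x m -` (region (blow_x m S) - {z. fst z = 0})"
    unfolding right_region_def shear_x_def region_def by force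
  have L: "left_region = shear_y m -` (region (blow_y m S) - {z. snd z = 0})"
    unfolding left_region_def shear_y_def region_def by force
  have mR: "right_region \<in> sets borel" and mL: "left_region \<in> sets borel"
    unfolding R L by (intro borel_shear sets.Diff bx bY borel_line_sets)+
  show "region S \<in> sets borel"
    unfolding region_decomp by (intro sets.Un low_region_borel mR mL)
  have "emeasure lborel (region S)
      = emeasure lborel low_region + emeasure lborel right_region + emeasure lborel left_region"
    using plus_emeasure[of low_region lborel right_region]
      plus_emeasure[of "low_region \<union> right_region" lborel left_region]
    by (simp add: region_decomp low_region_borel mR mL region_disjoint Int_Un_distrib2 sets.Un)
  also have "emeasure lborel right_region = emeasure lborel (region (blow_x m S))"
    unfolding R by (subst emeasure_shear) (auto intro!: emeasure_diff_null bx borel_line_sets sets.Diff negligible_axes)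
  also have "emeasure lborel left_region = emeasure lborel (region (blow_y m S))"
    unfolding L by (subst emeasure_shear) (auto intro!: emeasure_diff_null bY borel_line_sets sets.Diff negligible_axes)
  finally show "emeasure lborel (region S) = ennreal ((real m)\<^sup>2 / 2)
      + emeasure lborel (region (blow_x m S)) + emeasure lborel (region (blow_y m S))"
    by (simp add: emeasure_low_region)
qed

end

section \<open>Edges of the blown-up diagrams\<close>

lemma inj_shear: "inj (shear_x c)" "inj (shear_y c)"
  by (auto simp: inj_def shear_x_def shear_y_def prod_eq_iff)

lemma convex_hull_shear:
  "convex hull (shear_x c ` A) = shear_x c ` (convex hull A)"
  "convex hull (shear_y c ` A) = shear_y c ` (convex hull A)"
proof -
  let ?f = "\<lambda>z :: real \<times> real. (fst z + snd z, snd z)"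
  let ?g = "\<lambda>z :: real \<times> real. (fst z, fst z + snd z)"
  have "linear ?f" "linear ?g" by (auto intro!: linearI simp: algebra_simps)
  moreover have "shear_x c = (\<lambda>z. (- c, 0) + z) \<circ> ?f" "shear_y c = (\<lambda>z. (0, - c) + z) \<circ> ?g"
    by (auto simp: fun_eq_iff shear_x_def shear_y_def)
  ultimately show "convex hull (shear_x c ` A) = shear_x c ` (convex hull A)"
    "convex hull (shear_y c ` A) = shear_y c ` (convex hull A)"
    by (simp_all only: image_comp[symmetric] convex_hull_translation convex_hull_linear_image)
qed

text \<open>The shears are unimodular with integral translation part, so they preserve integrality
  in both directions.\<close>

lemma lattice_length_shear:
  "lattice_length (shear_x (real m) ` F) = lattice_length F"
  "lattice_length (shear_y (real m) ` F) = lattice_length F"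
proof -
  have img: "f ` F \<inter> T = f ` (F \<inter> T)" if "\<And>z. f z \<in> T \<longleftrightarrow> z \<in> T"
    for f :: "real \<times> real \<Rightarrow> real \<times> real" and T
    using that by auto
  have Z: "shear_x (real m) z \<in> \<int> \<times> \<int> \<longleftrightarrow> z \<in> \<int> \<times> \<int>"
    "shear_y (real m) z \<in> \<int> \<times> \<int> \<longleftrightarrow> z \<in> \<int> \<times> \<int>" for z
    using Ints_diff[of "fst z + snd z - real m" "snd z - real m"] Ints_diff[of "fst z + snd z - real m" "fst z - real m"]
    by (auto simp: shear_x_def shear_y_def mem_Times_iff)
  have "shear_x (real m) ` F \<inter> \<int> \<times> \<int> = shear_x (real m) ` (F \<inter> \<int> \<times> \<int>)"
    "shear_y (real m) ` F \<inter> \<int> \<times> \<int> = shear_y (real m) ` (F \<inter> \<int> \<times> \<int>)"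
    by (rule img, rule Z)+
  then show "lattice_length (shear_x (real m) ` F) = lattice_length F"
    "lattice_length (shear_y (real m) ` F) = lattice_length F"
    unfolding lattice_length_def by (simp_all add: card_image inj_on_subset[OF inj_shear(1)] inj_on_subset[OF inj_shear(2)])
qed

lemma under_eq:
  assumes "under p q S (real_pt u)" "under p q S (real_pt v)" "u \<in> S" "v \<in> S"
  shows "p * real (fst u) + q * real (snd u) = p * real (fst v) + q * real (snd v)"
  using underD[OF assms(1), of "fst v" "snd v"] underD[OF assms(2), of "fst u" "snd u"] assms(3,4)
  by (simp add: real_pt_def)

text \<open>Two distinct points of the edge span a nonzero vector orthogonal to both weight vectors,
  so these are proportional. Hence the trichotomy p < q, p = q, p > q is a property of the edge and
  not of the chosen weights.\<close>

lemma facet_weights_ratio: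
  assumes "facet_weights p q S" "facet_weights p' q' S" "min_face p q S = min_face p' q' S"
  shows "p * q' = p' * q"
proof -
  have pq: "0 < p" "0 < q" "0 < p'" "0 < q'" using assms by (auto simp: facet_weights_def)
  obtain u v where uv: "u \<in> min_points p q S" "v \<in> min_points p q S" "u \<noteq> v"
    using assms(1) by (auto simp: facet_weights_def)
  have S: "u \<in> S" "v \<in> S" using uv by (auto simp: min_points_def)
  have "real_pt u \<in> min_face p q S" "real_pt v \<in> min_face p q S"
    using uv by (auto simp: min_face_def intro: hull_inc)
  then have "under p q S (real_pt u)" "under p q S (real_pt v)"
    "under p' q' S (real_pt u)" "under p' q' S (real_pt v)"
    using min_face_eq[OF pq(1,2)] min_face_eq[OF pq(3,4)] assms(3) by blast+
  then have "p * real (fst u) + q * real (snd u) = p * real (fst v) + q * real (snd v)"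
    "p' * real (fst u) + q' * real (snd u) = p' * real (fst v) + q' * real (snd v)"
    using S by (auto intro: under_eq simp del: split_paired_All)
  then have e: "p * (real (fst u) - real (fst v)) = q * (real (snd v) - real (snd u))"
    "p' * (real (fst u) - real (fst v)) = q' * (real (snd v) - real (snd u))"
    by (simp_all add: algebra_simps)
  define a where "a = real (fst u) - real (fst v)"
  define b where "b = real (snd v) - real (snd u)"
  have e: "p * a = q * b" "p' * a = q' * b" using e by (simp_all add: a_def b_def)
  have "b \<noteq> 0"
  proof
    assume "b = 0"
    then have "a = 0" using e pq by simp
    with \<open>b = 0\<close> have "u = v" by (auto simp: a_def b_def prod_eq_iff)
    with uv(3) show False ..
  qed
  have "(p * q' - p' * q) * b = p * (q' * b) - p' * (q * b)" by (simp add: algebra_simps)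
  also have "\<dots> = 0" by (simp add: e[symmetric])
  finally show ?thesis using \<open>b \<noteq> 0\<close> by simp
qed

lemma ex_distinct_image:
  "inj_on f A \<Longrightarrow> (\<exists>u\<in>f ` A. \<exists>v\<in>f ` A. u \<noteq> v) \<longleftrightarrow> (\<exists>u\<in>A. \<exists>v\<in>A. u \<noteq> v)"
  by (simp add: inj_on_eq_iff cong: bex_cong)

lemma min_face_scale: "0 < c \<Longrightarrow> min_face (c * p) (c * q) S = min_face p q S"
  "0 < c \<Longrightarrow> facet_weights (c * p) (c * q) S \<longleftrightarrow> facet_weights p q S"
  by (simp_all add: min_face_def facet_weights_def min_points_def under_scale zero_less_mult_iff)

lemma image_Collect_eq:
  "(\<And>z. z \<in> A \<Longrightarrow> P (f z) \<longleftrightarrow> Q z) \<Longrightarrow> {z \<in> f ` A. P z} = f ` {z \<in> A. Q z}"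
  by auto

context newton_blow_up
begin

lemma real_pt_blow_x: "z \<in> S \<Longrightarrow> real_pt (case z of (i, j) \<Rightarrow> (i + j - m, j)) = shear_x m (real_pt z)"
  using order_le by (cases z) (auto simp: real_pt_def shear_x_def of_nat_diff)

lemma real_pt_blow_y: "z \<in> S \<Longrightarrow> real_pt (case z of (i, j) \<Rightarrow> (i, i + j - m)) = shear_y m (real_pt z)"
  using order_le by (cases z) (auto simp: real_pt_def shear_y_def of_nat_diff)

lemma min_points_blow_x: "min_points p q (blow_x m S) = (\<lambda>(i, j). (i + j - m, j)) ` min_points p (p + q) S"
proof -
  let ?f = "\<lambda>(i, j). (i + j - m, j)"
  have "under p q (?f ` S) (real_pt (?f z)) \<longleftrightarrow> under p (p + q) S (real_pt z)" if "z \<in> S" for z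
    using that by (simp only: real_pt_blow_x under_shear_x blow_x_def[symmetric])
  then show ?thesis
    unfolding min_points_def blow_x_def by (rule image_Collect_eq)
qed

lemma min_points_blow_y: "min_points p q (blow_y m S) = (\<lambda>(i, j). (i, i + j - m)) ` min_points (p + q) q S"
proof -
  let ?f = "\<lambda>(i, j). (i, i + j - m)"
  have "under p q (?f ` S) (real_pt (?f z)) \<longleftrightarrow> under (p + q) q S (real_pt z)" if "z \<in> S" for z
    using that by (simp only: real_pt_blow_y under_shear_y blow_y_def[symmetric])
  then show ?thesis
    unfolding min_points_def blow_y_def by (rule image_Collect_eq)
qed

lemma min_face_blow_x: "min_face p q (blow_x m S) = shear_x m ` min_face p (p + q) S"
proof -
  have "real_pt ` min_points p q (blow_x m S) = shear_x m ` real_pt ` min_points p (p + q) S"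
    unfolding min_points_blow_x image_image
    by (rule image_cong[OF refl]) (auto simp: min_points_def real_pt_blow_x[symmetric])
  then show ?thesis by (simp add: min_face_def convex_hull_shear)
qed

lemma min_face_blow_y: "min_face p q (blow_y m S) = shear_y m ` min_face (p + q) q S"
proof -
  have "real_pt ` min_points p q (blow_y m S) = shear_y m ` real_pt ` min_points (p + q) q S"
    unfolding min_points_blow_y image_image
    by (rule image_cong[OF refl]) (auto simp: min_points_def real_pt_blow_y[symmetric])
  then show ?thesis by (simp add: min_face_def convex_hull_shear)
qed

lemma facet_weights_blow_x:
  "facet_weights p q (blow_x m S) \<longleftrightarrow> 0 < q \<and> facet_weights p (p + q) S"
proof -
  have "inj_on (\<lambda>(i, j). (i + j - m, j)) (min_points p (p + q) S)"
    by (auto simp: inj_on_def min_points_def dest!: order_le)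
  note distinct = ex_distinct_image[OF this]
  show ?thesis
    unfolding facet_weights_def min_points_blow_x distinct
    by (metis add_pos_pos)
qed

lemma facet_weights_blow_y:
  "facet_weights p q (blow_y m S) \<longleftrightarrow> 0 < p \<and> facet_weights (p + q) q S"
proof -
  have "inj_on (\<lambda>(i, j). (i, i + j - m)) (min_points (p + q) q S)"
    by (auto simp: inj_on_def min_points_def dest!: order_le)
  note distinct = ex_distinct_image[OF this]
  show ?thesis
    unfolding facet_weights_def min_points_blow_y distinct
    by (metis add_pos_pos)
qed

lemma min_points_diagonal: "min_points 1 1 S = {(i, j) \<in> S. i + j = m}"
  unfolding min_points_def under_diagonal[OF zero_less_one]
  by (auto simp: real_pt_def simp flip: of_nat_add intro: le_antisym order_le)

lemma newton_facets_blow_x: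
  "(`) (shear_x m) ` {min_face p q S | p q. facet_weights p q S \<and> p < q} = newton_facets (blow_x m S)"
proof -
  have ne: "blow_x m S \<noteq> {}" using y_intercept_blow_x by blast
  show ?thesis
    unfolding newton_facets_eq[OF ne]
  proof (intro equalityI subsetI)
    fix F assume "F \<in> (`) (shear_x m) ` {min_face p q S | p q. facet_weights p q S \<and> p < q}"
    then obtain p q where "F = shear_x m ` min_face p q S" "facet_weights p q S" "p < q" by blast
    then have "F = min_face p (q - p) (blow_x m S)" "facet_weights p (q - p) (blow_x m S)"
      by (simp_all add: min_face_blow_x facet_weights_blow_x)
    then show "F \<in> {min_face p q (blow_x m S) | p q. facet_weights p q (blow_x m S)}" by blast
  next
    fix F assume "F \<in> {min_face p q (blow_x m S) | p q. facet_weights p q (blow_x m S)}"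
    then obtain p q where F: "F = shear_x m ` min_face p (p + q) S" "0 < q" "facet_weights p (p + q) S"
      by (auto simp: min_face_blow_x facet_weights_blow_x)
    moreover have "p < p + q" using F(2) by simp
    ultimately show "F \<in> (`) (shear_x m) ` {min_face p q S | p q. facet_weights p q S \<and> p < q}" by blast
  qed
qed

lemma newton_facets_blow_y:
  "(`) (shear_y m) ` {min_face p q S | p q. facet_weights p q S \<and> q < p} = newton_facets (blow_y m S)"
proof -
  have ne: "blow_y m S \<noteq> {}" using x_intercept_blow_y by blast
  show ?thesis
    unfolding newton_facets_eq[OF ne]
  proof (intro equalityI subsetI)
    fix F assume "F \<in> (`) (shear_y m) ` {min_face p q S | p q. facet_weights p q S \<and> q < p}"
    then obtain p q where "F = shear_y m ` min_face p q S" "facet_weights p q S" "q < p" by blast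
    then have "F = min_face (p - q) q (blow_y m S)" "facet_weights (p - q) q (blow_y m S)"
      by (simp_all add: min_face_blow_y facet_weights_blow_y)
    then show "F \<in> {min_face p q (blow_y m S) | p q. facet_weights p q (blow_y m S)}" by blast
  next
    fix F assume "F \<in> {min_face p q (blow_y m S) | p q. facet_weights p q (blow_y m S)}"
    then obtain p q where F: "F = shear_y m ` min_face (p + q) q S" "0 < p" "facet_weights (p + q) q S"
      by (auto simp: min_face_blow_y facet_weights_blow_y)
    moreover have "q < p + q" using F(2) by simp
    ultimately show "F \<in> (`) (shear_y m) ` {min_face p q S | p q. facet_weights p q S \<and> q < p}" by blast
  qed
qed

text \<open>An edge with equal weights survives in neither chart: each shear flattens it onto the
  exceptional axis. It has to be accounted for separately.\<close>

lemma newton_facets_decomp: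
  "newton_facets S = {min_face p q S | p q. facet_weights p q S \<and> p < q}
     \<union> {min_face p q S | p q. facet_weights p q S \<and> q < p}
     \<union> (if facet_weights 1 1 S then {min_face 1 1 S} else {})"
proof -
  have scale: "min_face p p S = min_face 1 1 S" "facet_weights 1 1 S" if "facet_weights p p S" for p
    using min_face_scale[of p 1 1] that by (auto simp: facet_weights_def)
  have "{min_face p q S | p q. facet_weights p q S \<and> p = q}
      = (if facet_weights 1 1 S then {min_face 1 1 S} else {})" (is "?A = ?B")
  proof (intro equalityI subsetI)
    fix F assume "F \<in> ?A"
    then obtain p where "facet_weights p p S" "F = min_face p p S" by blast
    then show "F \<in> ?B" using scale[of p] by simp
  next
    fix F assume "F \<in> ?B"
    then have "facet_weights 1 1 S" "F = min_face 1 1 S" by (simp_all split: if_splits)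
    then show "F \<in> ?A" by blast
  qed
  moreover have "{min_face p q S | p q. facet_weights p q S} = {min_face p q S | p q. facet_weights p q S \<and> p < q}
     \<union> {min_face p q S | p q. facet_weights p q S \<and> q < p}
     \<union> {min_face p q S | p q. facet_weights p q S \<and> p = q}"
    using linorder_less_linear by blast
  ultimately show ?thesis unfolding newton_facets_eq[OF nonempty] by simp
qed

text \<open>The lattice length of the face of slope -1, zero if that face is a vertex. In this form
  it absorbs the two exceptional intercepts that the charts subtract but the original diagram does
  not.\<close>

definition diagonal_length :: real where
  "diagonal_length = real m - real (y_intercept (blow_x m S)) - real (x_intercept (blow_y m S))"

lemma diagonal_points:
  defines "k \<equiv> y_intercept (blow_x m S)" and "l \<equiv> x_intercept (blow_y m S)"
  shows "k + l \<le> m" "(m - k, k) \<in> min_points 1 1 S" "(l, m - l) \<in> min_points 1 1 S"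
    and "(i, j) \<in> min_points 1 1 S \<Longrightarrow> i + j = m \<and> k \<le> j \<and> l \<le> i"
proof -
  have low: "i + j = m \<and> k \<le> j \<and> l \<le> i" if "(i, j) \<in> min_points 1 1 S" for i j
  proof -
    have ij: "(i, j) \<in> S" "i + j = m" using that by (auto simp: min_points_diagonal)
    then have "(0, j) \<in> blow_x m S" "(i, 0) \<in> blow_y m S" by (force simp: blow_x_def blow_y_def)+
    then show ?thesis using ij y_intercept(2) x_intercept(2) by (auto simp: k_def l_def)
  qed
  then show "(i, j) \<in> min_points 1 1 S \<Longrightarrow> i + j = m \<and> k \<le> j \<and> l \<le> i" .
  obtain i where i: "(i, k) \<in> S" "i + k - m = 0"
    using y_intercept_blow_x by (auto simp: blow_x_def k_def)
  then have "i + k = m" using order_le[OF i(1)] by simp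
  then show k: "(m - k, k) \<in> min_points 1 1 S" using i by (auto simp: min_points_diagonal)
  obtain j where j: "(l, j) \<in> S" "l + j - m = 0"
    using x_intercept_blow_y by (auto simp: blow_y_def l_def)
  then have "l + j = m" using order_le[OF j(1)] by simp
  then show "(l, m - l) \<in> min_points 1 1 S" using j by (auto simp: min_points_diagonal)
  show "k + l \<le> m" using low[OF k] by linarith
qed

lemma diagonal_length_nonneg: "0 \<le> diagonal_length"
  using diagonal_points(1) by (simp add: diagonal_length_def)

lemma facet_weights_diagonal: "facet_weights 1 1 S \<longleftrightarrow> 0 < diagonal_length"
proof
  assume "facet_weights 1 1 S"
  then obtain i j i' j' where ij: "(i, j) \<in> min_points 1 1 S" "(i', j') \<in> min_points 1 1 S" "(i, j) \<noteq> (i', j')"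
    by (force simp: facet_weights_def)
  have "y_intercept (blow_x m S) + x_intercept (blow_y m S) < m"
    using diagonal_points(4)[OF ij(1)] diagonal_points(4)[OF ij(2)] ij(3) by auto
  then show "0 < diagonal_length" by (simp add: diagonal_length_def)
next
  assume "0 < diagonal_length"
  then have "(m - y_intercept (blow_x m S), y_intercept (blow_x m S)) \<noteq> (x_intercept (blow_y m S), m - x_intercept (blow_y m S))"
    by (auto simp: diagonal_length_def)
  then show "facet_weights 1 1 S"
    unfolding facet_weights_def using diagonal_points(2,3) zero_less_one by blast
qed

lemma min_face_diagonal_bounds:
  assumes "z \<in> min_face 1 1 S"
  shows "fst z + snd z = real m" "real (y_intercept (blow_x m S)) \<le> snd z"
    "real (x_intercept (blow_y m S)) \<le> fst z"
proof -
  let ?k = "real (y_intercept (blow_x m S))" and ?l = "real (x_intercept (blow_y m S))"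
  let ?H = "{z :: real \<times> real. (1, 1) \<bullet> z = real m} \<inter> {z. (0, 1) \<bullet> z \<ge> ?k} \<inter> {z. (1, 0) \<bullet> z \<ge> ?l}"
  have "min_face 1 1 S \<subseteq> ?H"
    unfolding min_face_def
  proof (rule hull_minimal)
    show "real_pt ` min_points 1 1 S \<subseteq> ?H"
      using diagonal_points(4) by (force simp: real_pt_def inner_prod_def simp flip: of_nat_add)
    show "convex ?H" by (intro convex_Int convex_hyperplane convex_halfspace_ge)
  qed
  then show "fst z + snd z = real m" "?k \<le> snd z" "?l \<le> fst z"
    using assms by (auto simp: inner_prod_def)
qed

text \<open>The lattice points of the face are determined by their second coordinate, which runs
  from \<open>k\<close> to \<open>m - l\<close> between two support points.\<close>

lemma lattice_length_diagonal: "lattice_length (min_face 1 1 S) = diagonal_length"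
proof -
  define k l where "k = y_intercept (blow_x m S)" and "l = x_intercept (blow_y m S)"
  have kl: "k + l \<le> m" and P: "(m - k, k) \<in> min_points 1 1 S" and Q: "(l, m - l) \<in> min_points 1 1 S"
    using diagonal_points unfolding k_def l_def by blast+
  have PQ: "(real m - real k, real k) \<in> min_face 1 1 S" "(real l, real m - real l) \<in> min_face 1 1 S"
    using P Q kl hull_inc[of _ "real_pt ` min_points 1 1 S" convex]
    unfolding min_face_def by (force simp: real_pt_def of_nat_diff)+
  have cvx: "convex (min_face 1 1 S)" by (simp add: min_face_def)
  have "min_face 1 1 S \<inter> \<int> \<times> \<int> = (\<lambda>j. (real m - real j, real j)) ` {k..m - l}"
  proof (intro equalityI subsetI)
    fix z assume z: "z \<in> min_face 1 1 S \<inter> \<int> \<times> \<int>"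
    then obtain n where n: "snd z = of_int n" by (auto elim: Ints_cases)
    have b: "fst z + snd z = real m" "real k \<le> snd z" "real l \<le> fst z"
      using z min_face_diagonal_bounds[of z] by (auto simp: k_def l_def)
    have "0 \<le> n" using b(2) n by linarith
    then have j: "snd z = real (nat n)" using n by simp
    then have "z = (real m - real (nat n), real (nat n))" using b by (simp add: prod_eq_iff)
    moreover have "nat n \<in> {k..m - l}" using b j by auto
    ultimately show "z \<in> (\<lambda>j. (real m - real j, real j)) ` {k..m - l}" by blast
  next
    fix z assume "z \<in> (\<lambda>j. (real m - real j, real j)) ` {k..m - l}"
    then obtain j where j: "k \<le> j" "j \<le> m - l" "z = (real m - real j, real j)" by auto
    have "z \<in> min_face 1 1 S"
    proof (cases "k = m - l")
      case True
      then show ?thesis using j PQ(1) by simp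
    next
      case False
      define d where "d = real m - real l - real k"
      have d: "0 < d" using False kl by (auto simp: d_def)
      \<comment> \<open>The position of height \<open>j\<close> on the segment from height
        \<open>k\<close> to height \<open>m - l\<close>.\<close>
      define u where "u = (real j - real k) / d"
      have ud: "u * d = real j - real k" using d by (simp add: u_def)
      have u: "0 \<le> u" "u \<le> 1" using j d by (auto simp: u_def d_def)
      have "(1 - u) *\<^sub>R (real m - real k, real k) + u *\<^sub>R (real l, real m - real l) \<in> min_face 1 1 S"
        using convexD_alt[OF cvx PQ u] .
      moreover have "(1 - u) *\<^sub>R (real m - real k, real k) + u *\<^sub>R (real l, real m - real l)
          = (real m - real k - u * d, real k + u * d)"
        by (simp add: d_def algebra_simps)
      ultimately show ?thesis unfolding ud using j by simp
    qed
    then show "z \<in> min_face 1 1 S \<inter> \<int> \<times> \<int>" using j by auto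
  qed
  moreover have "inj_on (\<lambda>j. (real m - real j, real j)) {k..m - l}" by (auto simp: inj_on_def)
  ultimately have "card (min_face 1 1 S \<inter> \<int> \<times> \<int>) = m - l + 1 - k"
    by (simp add: card_image)
  then show ?thesis
    using kl unfolding lattice_length_def diagonal_length_def k_def[symmetric] l_def[symmetric]
    by (simp add: of_nat_diff)
qed

text \<open>Edges are sorted by the sign of q - p. The equal case contributes
  \<open>diagonal_length\<close> uniformly, since this is zero when there is no such edge.\<close>

lemma sum_lattice_length:
  assumes fin: "finite (newton_facets (blow_x m S))" "finite (newton_facets (blow_y m S))"
  shows "finite (newton_facets S)"
    and "(\<Sum>F\<in>newton_facets S. lattice_length F) = (\<Sum>F\<in>newton_facets (blow_x m S). lattice_length F)
      + (\<Sum>F\<in>newton_facets (blow_y m S). lattice_length F) + diagonal_length"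
proof -
  define X where "X = {min_face p q S | p q. facet_weights p q S \<and> p < q}"
  define Y where "Y = {min_face p q S | p q. facet_weights p q S \<and> q < p}"
  define Z where "Z = (if facet_weights 1 1 S then {min_face 1 1 S} else {})"
  have inj: "inj_on ((`) (shear_x m)) X" "inj_on ((`) (shear_y m)) Y"
    by (meson inj_shear inj_image_eq_iff inj_onI)+
  have blow: "newton_facets (blow_x m S) = (`) (shear_x m) ` X" "newton_facets (blow_y m S) = (`) (shear_y m) ` Y"
    unfolding X_def Y_def newton_facets_blow_x newton_facets_blow_y by simp_all
  have decomp: "newton_facets S = X \<union> Y \<union> Z"
    unfolding X_def Y_def Z_def by (rule newton_facets_decomp)
  have finXY: "finite X" "finite Y" "finite Z"
    using fin inj unfolding blow Z_def by (auto simp: finite_image_iff)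
  then show "finite (newton_facets S)" unfolding decomp by simp
  have pos: "0 < p \<and> 0 < q" if "facet_weights p q S" for p q using that by (simp add: facet_weights_def)
  have ratio: "p < q \<longleftrightarrow> p' < q'"
    if "facet_weights p q S" "facet_weights p' q' S" "min_face p q S = min_face p' q' S" for p q p' q'
  proof -
    have "p * q' = p' * q" using facet_weights_ratio that by blast
    then have "p / q = p' / q'" using pos[OF that(1)] pos[OF that(2)] by (simp add: field_simps)
    moreover have "p < q \<longleftrightarrow> p / q < 1" "p' < q' \<longleftrightarrow> p' / q' < 1"
      using pos[OF that(1)] pos[OF that(2)] by (simp_all add: divide_less_eq_1)
    ultimately show ?thesis by simp
  qed
  have ratio': "q < p \<longleftrightarrow> q' < p'"
    if "facet_weights p q S" "facet_weights p' q' S" "min_face p q S = min_face p' q' S" for p q p' q'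
  proof -
    have "p * q' = p' * q" using facet_weights_ratio that by blast
    then have "q / p = q' / p'" using pos[OF that(1)] pos[OF that(2)] by (simp add: field_simps)
    moreover have "q < p \<longleftrightarrow> q / p < 1" "q' < p' \<longleftrightarrow> q' / p' < 1"
      using pos[OF that(1)] pos[OF that(2)] by (simp_all add: divide_less_eq_1)
    ultimately show ?thesis by simp
  qed
  have disj: "X \<inter> Y = {}" "X \<inter> Z = {}" "Y \<inter> Z = {}"
  proof -
    show "X \<inter> Y = {}"
    proof (rule equals0I)
      fix F assume "F \<in> X \<inter> Y"
      then obtain p q p' q' where "facet_weights p q S" "p < q" "facet_weights p' q' S" "q' < p'"
        "min_face p q S = min_face p' q' S" unfolding X_def Y_def by blast
      then show False using ratio[of p q p' q'] by simp
    qed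
    show "X \<inter> Z = {}"
    proof (rule equals0I)
      fix F assume "F \<in> X \<inter> Z"
      then obtain p q where "facet_weights p q S" "p < q" "facet_weights 1 1 S"
        "min_face p q S = min_face 1 1 S" unfolding X_def Z_def by (auto split: if_splits)
      then show False using ratio[of p q 1 1] by simp
    qed
    show "Y \<inter> Z = {}"
    proof (rule equals0I)
      fix F assume "F \<in> Y \<inter> Z"
      then obtain p q where "facet_weights p q S" "q < p" "facet_weights 1 1 S"
        "min_face p q S = min_face 1 1 S" unfolding Y_def Z_def by (auto split: if_splits)
      then show False using ratio'[of p q 1 1] by simp
    qed
  qed
  have "(\<Sum>F\<in>newton_facets S. lattice_length F)
      = (\<Sum>F\<in>X. lattice_length F) + (\<Sum>F\<in>Y. lattice_length F) + (\<Sum>F\<in>Z. lattice_length F)"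
    unfolding decomp using finXY disj by (simp add: sum.union_disjoint Int_Un_distrib2)
  moreover have "(\<Sum>F\<in>newton_facets (blow_x m S). lattice_length F) = (\<Sum>F\<in>X. lattice_length F)"
    unfolding blow by (simp add: sum.reindex[OF inj(1)] lattice_length_shear)
  moreover have "(\<Sum>F\<in>newton_facets (blow_y m S). lattice_length F) = (\<Sum>F\<in>Y. lattice_length F)"
    unfolding blow by (simp add: sum.reindex[OF inj(2)] lattice_length_shear)
  moreover have "(\<Sum>F\<in>Z. lattice_length F) = diagonal_length"
    using diagonal_length_nonneg by (simp add: Z_def lattice_length_diagonal facet_weights_diagonal)
  ultimately show "(\<Sum>F\<in>newton_facets S. lattice_length F) = (\<Sum>F\<in>newton_facets (blow_x m S). lattice_length F)
      + (\<Sum>F\<in>newton_facets (blow_y m S). lattice_length F) + diagonal_length"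
    by simp
qed

end

section \<open>The Newton number counts lattice points\<close>

definition order_of :: "(nat \<times> nat) set \<Rightarrow> nat" where
  "order_of S = (LEAST n. \<exists>i j. (i, j) \<in> S \<and> i + j = n)"

lemma newton_blow_up_order_of:
  assumes "S \<noteq> {}"
  shows "newton_blow_up S (order_of S)"
proof
  show "order_of S \<le> i + j" if "(i, j) \<in> S" for i j
    unfolding order_of_def using that by (intro Least_le) blast
  have "\<exists>n i j. (i, j) \<in> S \<and> i + j = n" using assms by auto
  then show "\<exists>i j. (i, j) \<in> S \<and> i + j = order_of S"
    unfolding order_of_def by (rule LeastI_ex)
qed

lemma under_origin:
  assumes "(0, 0) \<in> S" "0 < p" "0 < q" "under p q S z" "0 \<le> fst z" "0 \<le> snd z"
  shows "z = 0"
proof -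
  have "p * fst z + q * snd z \<le> 0" using underD[OF assms(4,1)] by simp
  moreover have "0 \<le> p * fst z" "0 \<le> q * snd z" using assms by simp_all
  ultimately have "p * fst z = 0" "q * snd z = 0" by linarith+
  then show ?thesis using assms by (simp add: prod_eq_iff)
qed

lemma region_origin:
  assumes "(0, 0) \<in> S"
  shows "region S = {0}"
proof (intro equalityI subsetI)
  fix z assume "z \<in> region S"
  then show "z \<in> {0}" using under_origin[OF assms, of _ _ z] unfolding region_def by blast
next
  fix z :: "real \<times> real" assume "z \<in> {0}"
  then have "under 1 1 S z" by (auto simp: under_def)
  then show "z \<in> region S" using \<open>z \<in> {0}\<close> by (intro regionI[of 1 1]) auto
qed

lemma inner_points_origin: "(0, 0) \<in> S \<Longrightarrow> inner_points S = {}"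
  by (auto simp: inner_points_def region_origin real_pt_def zero_prod_def)

lemma newton_facets_origin:
  assumes "(0, 0) \<in> S"
  shows "newton_facets S = {}"
proof -
  have "\<not> facet_weights p q S" for p q
  proof
    assume "facet_weights p q S"
    then obtain u v where pq: "0 < p" "0 < q" and uv: "u \<in> min_points p q S" "v \<in> min_points p q S" "u \<noteq> v"
      by (auto simp: facet_weights_def)
    have "real_pt w = 0" if "w \<in> min_points p q S" for w
      using that by (intro under_origin[OF assms pq]) (auto simp: min_points_def real_pt_def)
    then have "real_pt u = real_pt v" using uv by simp
    then show False using uv(3) inj_real_pt by (auto dest: injD)
  qed
  then show ?thesis using newton_facets_eq[of S] assms by auto
qed

lemma real_half_pred: "1 \<le> m \<Longrightarrow> real (m * (m - 1) div 2) = real m * (real m - 1) / 2"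
  by (simp add: real_of_nat_div of_nat_diff)

text \<open>The x-chart lowers the x-intercept by the order m and has y-intercept at most m, which
  is at most the old one; symmetrically in the y-chart. So the sum of the intercepts drops until the
  origin lies in the support, where all terms vanish. Measurability and finiteness are carried along
  because \<open>measure\<close>, \<open>sum\<close> and \<open>card\<close> are only additive under
  them.\<close>

lemma newton_number_aux:
  assumes "(a, 0) \<in> S" "(0, b) \<in> S"
  shows "region S \<in> sets borel \<and> emeasure lborel (region S) < \<infinity> \<and> finite (newton_facets S)
    \<and> finite (inner_points S)
    \<and> measure lborel (region S) - (real (x_intercept S) + real (y_intercept S)) / 2
        + (\<Sum>F\<in>newton_facets S. lattice_length F) / 2 = real (card (inner_points S))"
  using assms
proof (induction "x_intercept S + y_intercept S" arbitrary: S a b rule: less_induct)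
  case less
  show ?case
  proof (cases "(0, 0) \<in> S")
    case True
    have "x_intercept S = 0" "y_intercept S = 0"
      using x_intercept(2)[OF True] y_intercept(2)[OF True] by auto
    then show ?thesis
      by (simp add: region_origin newton_facets_origin inner_points_origin True)
  next
    case False
    define m where "m = order_of S"
    interpret newton_blow_up S m
      unfolding m_def using less.prems by (intro newton_blow_up_order_of) auto
    let ?X = "blow_x m S" and ?Y = "blow_y m S"
    have ax: "(x_intercept S, 0) \<in> S" and ay: "(0, y_intercept S) \<in> S"
      using less.prems x_intercept(1) y_intercept(1) by blast+
    have mx: "m \<le> x_intercept S" and my: "m \<le> y_intercept S"
      using order_le[OF ax] order_le[OF ay] by simp_all
    \<comment> \<open>Order zero would put the origin into the support; m >= 1 is what makes both
      intercept sums drop strictly.\<close>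
    have m1: "1 \<le> m"
    proof (rule ccontr)
      assume "\<not> 1 \<le> m"
      then have "m = 0" by simp
      then show False using order_attained False by auto
    qed
    have X0: "(x_intercept S - m, 0) \<in> ?X" using ax by (force simp: blow_x_def)
    have Y0: "(0, y_intercept S - m) \<in> ?Y" using ay by (force simp: blow_y_def)
    have xX: "x_intercept ?X = x_intercept S - m"
    proof (rule antisym)
      show "x_intercept ?X \<le> x_intercept S - m" using x_intercept(2)[OF X0] .
      obtain i where "(i, 0) \<in> S" "x_intercept ?X = i - m"
        using x_intercept(1)[OF X0] by (auto simp: blow_x_def)
      then show "x_intercept S - m \<le> x_intercept ?X" using x_intercept(2)[of i S] by simp
    qed
    have yY: "y_intercept ?Y = y_intercept S - m"
    proof (rule antisym)
      show "y_intercept ?Y \<le> y_intercept S - m" using y_intercept(2)[OF Y0] .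
      obtain j where "(0, j) \<in> S" "y_intercept ?Y = j - m"
        using y_intercept(1)[OF Y0] by (auto simp: blow_y_def)
      then show "y_intercept S - m \<le> y_intercept ?Y" using y_intercept(2)[of j S] by simp
    qed
    have "x_intercept ?X + y_intercept ?X < x_intercept S + y_intercept S"
      using xX y_intercept_blow_x_le mx my m1 by linarith
    note IHX = less.hyps[OF this X0 y_intercept_blow_x]
    have "x_intercept ?Y + y_intercept ?Y < x_intercept S + y_intercept S"
      using yY x_intercept_blow_y_le mx my m1 by linarith
    note IHY = less.hyps[OF this x_intercept_blow_y Y0]
    have bX: "region ?X \<in> sets borel" and bY: "region ?Y \<in> sets borel"
      and fX: "emeasure lborel (region ?X) < \<infinity>" and fY: "emeasure lborel (region ?Y) < \<infinity>"
      using IHX IHY by blast+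
    have finF: "finite (newton_facets ?X)" "finite (newton_facets ?Y)" using IHX IHY by blast+
    have finI: "finite (inner_points S)" using IHX IHY finite_inner_points_iff by blast
    have em: "emeasure lborel (region S)
        = ennreal ((real m)\<^sup>2 / 2 + measure lborel (region ?X) + measure lborel (region ?Y))"
      using emeasure_region_blow_up(2)[OF bX bY] fX fY
      by (simp add: emeasure_eq_ennreal_measure less_top[symmetric])
    then have "measure lborel (region S)
        = (real m)\<^sup>2 / 2 + measure lborel (region ?X) + measure lborel (region ?Y)"
      by (simp add: measure_eq_emeasure_eq_ennreal)
    moreover have "real (x_intercept S) = real (x_intercept ?X) + real m"
      "real (y_intercept S) = real (y_intercept ?Y) + real m"
      using mx my by (simp_all add: xX yY of_nat_diff)
    moreover have "real (card (inner_points S))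
        = real m * (real m - 1) / 2 + real (card (inner_points ?X)) + real (card (inner_points ?Y))"
      using card_inner_points[OF finI] m1 real_half_pred[OF m1] by simp
    moreover note sum_lattice_length(2)[OF finF]
    moreover have "real (card (inner_points ?X)) = measure lborel (region ?X)
        - (real (x_intercept ?X) + real (y_intercept ?X)) / 2 + (\<Sum>F\<in>newton_facets ?X. lattice_length F) / 2"
      "real (card (inner_points ?Y)) = measure lborel (region ?Y)
        - (real (x_intercept ?Y) + real (y_intercept ?Y)) / 2 + (\<Sum>F\<in>newton_facets ?Y. lattice_length F) / 2"
      using IHX IHY by simp_all
    \<comment> \<open>The new terms are m^2/2 from the triangle, -m from the two lowered intercepts
      and m/2 from \<open>diagonal_length\<close>: together m (m - 1) / 2. The rest of
      \<open>diagonal_length\<close> supplies the exceptional intercepts of the two charts.\<close>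
    ultimately have "measure lborel (region S) - (real (x_intercept S) + real (y_intercept S)) / 2
        + (\<Sum>F\<in>newton_facets S. lattice_length F) / 2 = real (card (inner_points S))"
      by (simp add: diagonal_length_def field_simps power2_eq_square)
    then show ?thesis
      using emeasure_region_blow_up(1)[OF bX bY] em sum_lattice_length(1)[OF finF] finI by simp
  qed
qed

lemma newton_number_inner_points:
  assumes "(a, 0) \<in> S" "(0, b) \<in> S"
  shows "finite (inner_points S)" "newton_number S = real (card (inner_points S))"
  using newton_number_aux[OF assms] newton_number_eq[OF assms] by simp_all

text \<open>An infinite set must not get \<open>card\<close> 0: already x^2 has infinitely many
  inner points.\<close>

definition esize :: "'b set \<Rightarrow> enat" where
  "esize A = (if finite A then enat (card A) else \<infinity>)"

lemma inner_points_antimono: "S \<subseteq> T \<Longrightarrow> inner_points T \<subseteq> inner_points S"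
  by (auto simp: inner_points_def region_def) (meson subsetD under_def)

text \<open>The functional certifying \<open>z\<close> takes the values p m and q m at the two new
  points, and these eventually exceed its value at \<open>z\<close>.\<close>

lemma eventually_inner_points:
  assumes "z \<in> inner_points S"
  shows "\<forall>\<^sub>F m in sequentially. z \<in> inner_points (S \<union> {(m, 0), (0, m)})"
proof -
  obtain i j where ij: "z = (i, j)" by (cases z)
  then obtain p q where pq: "0 < p" "0 < q" "under p q S (real_pt z)"
    using assms by (auto simp: inner_points_def region_def)
  define c where "c = p * real i + q * real j"
  obtain M where M: "c / p \<le> real M" "c / q \<le> real M"
    by (metis (no_types) linear order_trans real_arch_simple)
  have "z \<in> inner_points (S \<union> {(m, 0), (0, m)})" if "M \<le> m" for m
  proof -
    have "c / p \<le> real m" "c / q \<le> real m" using M that by (meson of_nat_mono order_trans)+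
    then have "c \<le> p * real m" "c \<le> q * real m" using pq by (simp_all add: pos_divide_le_eq mult.commute)
    then have "under p q (S \<union> {(m, 0), (0, m)}) (real_pt z)"
      using pq(3) by (auto simp: under_def c_def ij real_pt_def)
    then show ?thesis
      using assms pq unfolding ij inner_points_def by (auto intro!: regionI[of p q] simp: real_pt_def)
  qed
  then show ?thesis by (auto simp: eventually_sequentially)
qed

text \<open>Adding the points (m, 0) and (0, m) can only remove inner points, but every finite set
  of inner points survives for large m. So the supremum is the full count, finite or not.\<close>

lemma delta_N_eq:
  assumes "f \<noteq> 0"
  shows "delta_N f = ereal_of_enat (esize (inner_points (supp f)))"
proof (cases "convenient (supp f)")
  case True
  then obtain a b where ab: "(a, 0) \<in> supp f" "(0, b) \<in> supp f" by (rule convenient_axis_points)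
  then show ?thesis
    using newton_number_inner_points[OF ab] True by (simp add: delta_N_def esize_def)
next
  case False
  let ?S = "\<lambda>m. supp f \<union> {(m, 0), (0, m)}"
  have nn: "finite (inner_points (?S m))" "newton_number (?S m) = real (card (inner_points (?S m)))" for m
    using newton_number_inner_points[of m "?S m" m] by auto
  have sub: "inner_points (?S m) \<subseteq> inner_points (supp f)" for m
    by (rule inner_points_antimono) blast
  let ?sup = "SUP m\<in>{1..}. ereal (newton_number (?S m))"
  have lower: "ereal (real (card A)) \<le> ?sup" if A: "finite A" "A \<subseteq> inner_points (supp f)" for A
  proof -
    have "\<forall>\<^sub>F m in sequentially. \<forall>z\<in>A. z \<in> inner_points (?S m)"
      by (intro eventually_ball_finite ballI eventually_inner_points) (use A in auto)
    then have "\<forall>\<^sub>F m in sequentially. 1 \<le> m \<and> (\<forall>z\<in>A. z \<in> inner_points (?S m))"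
      using eventually_ge_at_top[of 1] by eventually_elim auto
    then obtain m where m: "1 \<le> m" "A \<subseteq> inner_points (?S m)"
      using eventually_happens'[OF sequentially_bot] by blast
    then have "ereal (real (card A)) \<le> ereal (newton_number (?S m))"
      using card_mono[OF nn(1) m(2)] unfolding nn(2) by simp
    also have "\<dots> \<le> ?sup" using m(1) by (intro SUP_upper) auto
    finally show ?thesis .
  qed
  have "?sup = ereal_of_enat (esize (inner_points (supp f)))"
  proof (cases "finite (inner_points (supp f))")
    case True
    have "?sup \<le> ereal (real (card (inner_points (supp f))))"
      unfolding nn(2) using card_mono[OF True sub] by (intro SUP_least) simp
    then show ?thesis using lower[OF True order_refl] True by (simp add: esize_def antisym)
  next
    case inf: False
    have large: "ereal (real n) \<le> ?sup" for n
    proof -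
      obtain A where "A \<subseteq> inner_points (supp f)" "finite A" "card A = n"
        using infinite_arbitrarily_large[OF inf] by blast
      then show ?thesis using lower by blast
    qed
    have "?sup = \<infinity>"
    proof (rule ereal_top)
      fix B :: real
      obtain n where "B \<le> real n" using real_arch_simple by blast
      then have "ereal B \<le> ereal (real n)" by simp
      also note large[of n]
      finally show "ereal B \<le> ?sup" .
    qed
    then show ?thesis using inf by (simp add: esize_def)
  qed
  then show ?thesis using False by (simp add: delta_N_def)
qed

section \<open>Strict transforms and initial forms\<close>

lemma supp_iff: "(i, j) \<in> supp f \<longleftrightarrow> f $ i $ j \<noteq> 0"
  by (simp add: supp_def)

lemma supp_nonempty: "f \<noteq> 0 \<Longrightarrow> supp f \<noteq> {}"
  by (auto simp: supp_def fps_eq_iff)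

lemma mult_eq_order_of: "mult f = order_of (supp f)"
  by (simp add: mult_def order_of_def supp_iff conj_commute)

lemma newton_blow_up_supp: "f \<noteq> 0 \<Longrightarrow> newton_blow_up (supp f) (mult f)"
  unfolding mult_eq_order_of by (intro newton_blow_up_order_of supp_nonempty)

lemma coeff_below_mult: "i + j < mult f \<Longrightarrow> f $ i $ j = 0"
  unfolding mult_def by (blast dest: not_less_Least)

text \<open>At a torus-fixed point distinct monomials pull back to distinct monomials, so
  coefficients neither merge nor cancel and the support transforms exactly.\<close>

lemma supp_strict_transform_None:
  assumes "f \<noteq> 0"
  shows "supp (strict_transform None f) = blow_y (mult f) (supp f)"
proof -
  interpret newton_blow_up "supp f" "mult f" using assms by (rule newton_blow_up_supp)
  have "(i, k) \<in> supp (strict_transform None f) \<longleftrightarrow> i \<le> k + mult f \<and> (i, k + mult f - i) \<in> supp f" for i k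
    by (simp add: supp_iff)
  moreover have "(i, k) \<in> blow_y (mult f) (supp f) \<longleftrightarrow> i \<le> k + mult f \<and> (i, k + mult f - i) \<in> supp f" for i k
    by (auto simp: blow_y_def image_iff dest: order_le intro!: bexI[of _ "(i, k + mult f - i)"])
      (use order_le in fastforce)+
  ultimately show ?thesis by auto
qed

lemma strict_transform_Some_0_coeff:
  "strict_transform (Some 0) f $ n $ j = (if j \<le> n + mult f then f $ (n + mult f - j) $ j else 0)"
proof -
  have "([:0, 1:] :: 'a::comm_ring_1 poly) ^ j = monom 1 j" for j
    by (simp add: monom_altdef)
  then show ?thesis
    by (simp add: coeff_sum coeff_monom sum.delta smult_monom)
qed

lemma supp_strict_transform_Some_0:
  assumes "f \<noteq> 0"
  shows "supp (strict_transform (Some 0) f) = blow_x (mult f) (supp f)"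
proof -
  interpret newton_blow_up "supp f" "mult f" using assms by (rule newton_blow_up_supp)
  have "(n, j) \<in> supp (strict_transform (Some 0) f) \<longleftrightarrow> j \<le> n + mult f \<and> (n + mult f - j, j) \<in> supp f" for n j
    unfolding supp_iff strict_transform_Some_0_coeff by simp
  moreover have "(n, j) \<in> blow_x (mult f) (supp f) \<longleftrightarrow> j \<le> n + mult f \<and> (n + mult f - j, j) \<in> supp f" for n j
    by (auto simp: blow_x_def image_iff dest: order_le intro!: bexI[of _ "(n + mult f - j, j)"])
      (use order_le in fastforce)+
  ultimately show ?thesis by auto
qed

lemma strict_transform_nonzero:
  fixes f :: "'a::comm_ring_1 fps fps"
  assumes "f \<noteq> 0"
  shows "strict_transform (Some 0) f \<noteq> 0" "strict_transform None f \<noteq> 0"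
proof -
  interpret newton_blow_up "supp f" "mult f" using assms by (rule newton_blow_up_supp)
  have "supp (strict_transform (Some 0) f) \<noteq> {}" "supp (strict_transform None f) \<noteq> {}"
    unfolding supp_strict_transform_Some_0[OF assms] supp_strict_transform_None[OF assms]
    using y_intercept_blow_x x_intercept_blow_y by blast+
  moreover have "supp (0 :: 'a fps fps) = {}" by (simp add: supp_def)
  ultimately show "strict_transform (Some 0) f \<noteq> 0" "strict_transform None f \<noteq> 0"
    by metis+
qed

section \<open>Multiplicities on the exceptional divisor and singular points of edge
  polynomials\<close>

lemma pderiv_sum: "pderiv (\<Sum>x\<in>A. g x) = (\<Sum>x\<in>A. pderiv (g x))"
  using higher_pderiv_sum[of 1 g A] by simp

text \<open>On the exceptional line the strict transform restricts to the dehomogenised tangent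
  cone, translated by \<open>c\<close>. Multiplicity at least 2 kills its constant and linear
  coefficients, so \<open>c\<close> is a multiple root.\<close>

lemma strict_transform_Some_mult_ge_2:
  fixes f :: "'a::idom fps fps"
  assumes "2 \<le> mult (strict_transform (Some c) f)"
  shows "(\<Sum>j\<le>mult f. f $ (mult f - j) $ j * c ^ j) = 0"
    and "(\<Sum>j\<le>mult f. of_nat j * (f $ (mult f - j) $ j * c ^ j)) = 0"
proof -
  define m where "m = mult f"
  define P where "P = (\<Sum>j\<le>m. smult (f $ (m - j) $ j) ([:c, 1:] ^ j))"
  have "strict_transform (Some c) f $ 0 $ k = coeff P k" for k
    by (simp add: P_def m_def)
  then have P0: "coeff P 0 = 0" "coeff P 1 = 0"
    using coeff_below_mult[of 0 0 "strict_transform (Some c) f"]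
      coeff_below_mult[of 0 1 "strict_transform (Some c) f"] assms by auto
  have "poly P 0 = (\<Sum>j\<le>m. f $ (m - j) $ j * c ^ j)"
    by (simp add: P_def poly_sum poly_power)
  then show "(\<Sum>j\<le>mult f. f $ (mult f - j) $ j * c ^ j) = 0"
    using P0 by (simp add: poly_0_coeff_0 m_def)
  have "poly (pderiv P) 0 = (\<Sum>j\<le>m. of_nat j * (f $ (m - j) $ j * c ^ (j - 1)))"
    by (simp add: P_def pderiv_sum poly_sum poly_power pderiv_smult pderiv_power pderiv_pCons algebra_simps)
  also have "poly (pderiv P) 0 = 0" using P0 by (simp add: poly_0_coeff_0 coeff_pderiv)
  \<comment> \<open>Multiplying the derivative by \<open>c\<close> turns it into the sum weighted by
    exponents.\<close>
  finally have "c * (\<Sum>j\<le>m. of_nat j * (f $ (m - j) $ j * c ^ (j - 1))) = 0" by simp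
  also have "c * (\<Sum>j\<le>m. of_nat j * (f $ (m - j) $ j * c ^ (j - 1)))
      = (\<Sum>j\<le>m. of_nat j * (f $ (m - j) $ j * c ^ j))"
    unfolding sum_distrib_left
  proof (rule sum.cong[OF refl])
    fix j
    show "c * (of_nat j * (f $ (m - j) $ j * c ^ (j - 1))) = of_nat j * (f $ (m - j) $ j * c ^ j)"
      by (cases j) (simp_all add: algebra_simps)
  qed
  finally show "(\<Sum>j\<le>mult f. of_nat j * (f $ (mult f - j) $ j * c ^ j)) = 0" by (simp add: m_def)
qed

text \<open>Multiplying the partial derivatives by the coordinates restores the exponents lowered by
  differentiation, so all three sums run over the same terms.\<close>

lemma eval2_init_form:
  fixes f :: "'a::idom fps fps"
  assumes fin: "finite {z. real_pt z \<in> \<Delta>}"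
  defines "T \<equiv> {z. real_pt z \<in> \<Delta>}"
  shows "eval2 (init_form \<Delta> f) a b = (\<Sum>(i, j)\<in>T. f $ i $ j * a ^ i * b ^ j)"
    and "a * eval2 (deriv_x (init_form \<Delta> f)) a b = (\<Sum>(i, j)\<in>T. of_nat i * (f $ i $ j * a ^ i * b ^ j))"
    and "b * eval2 (deriv_y (init_form \<Delta> f)) a b = (\<Sum>(i, j)\<in>T. of_nat j * (f $ i $ j * a ^ i * b ^ j))"
proof -
  have form: "init_form \<Delta> f = (\<Sum>(i, j)\<in>T. monom (monom (f $ i $ j) j) i)"
    unfolding init_form_def T_def by (rule sum.cong) (auto simp: real_pt_def)
  have eval_monom: "eval2 (monom (monom c j) i) a b = c * a ^ i * b ^ j" for c and i j
    by (simp add: eval2_def poly_monom poly_power algebra_simps)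
  have eval_sum: "eval2 (\<Sum>z\<in>A. g z) a b = (\<Sum>z\<in>A. eval2 (g z) a b)" for g :: "nat \<times> nat \<Rightarrow> _" and A
    by (simp add: eval2_def poly_sum)
  show "eval2 (init_form \<Delta> f) a b = (\<Sum>(i, j)\<in>T. f $ i $ j * a ^ i * b ^ j)"
    unfolding form eval_sum by (rule sum.cong) (auto simp: eval_monom)
  have "deriv_x (init_form \<Delta> f) = (\<Sum>(i, j)\<in>T. monom (monom (of_nat i * f $ i $ j) j) (i - 1))"
    unfolding form deriv_x_def pderiv_sum
    by (rule sum.cong) (auto simp: pderiv_monom of_nat_poly smult_monom)
  then have "a * eval2 (deriv_x (init_form \<Delta> f)) a b
      = (\<Sum>(i, j)\<in>T. a * (of_nat i * f $ i $ j * a ^ (i - 1) * b ^ j))"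
    by (simp add: eval_sum sum_distrib_left case_prod_unfold eval_monom)
  also have "\<dots> = (\<Sum>(i, j)\<in>T. of_nat i * (f $ i $ j * a ^ i * b ^ j))"
  proof (rule sum.cong[OF refl], clarify)
    fix i j
    show "a * (of_nat i * f $ i $ j * a ^ (i - 1) * b ^ j) = of_nat i * (f $ i $ j * a ^ i * b ^ j)"
      by (cases i) (simp_all add: algebra_simps)
  qed
  finally show "a * eval2 (deriv_x (init_form \<Delta> f)) a b = (\<Sum>(i, j)\<in>T. of_nat i * (f $ i $ j * a ^ i * b ^ j))" .
  have "deriv_y (init_form \<Delta> f) = (\<Sum>(i, j)\<in>T. monom (monom (of_nat j * f $ i $ j) (j - 1)) i)"
    unfolding form deriv_y_def
    by (rule poly_eqI)
      (simp add: coeff_map_poly coeff_sum pderiv_sum case_prod_unfold pderiv_monom coeff_monom if_distrib cong: if_cong)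
  then have "b * eval2 (deriv_y (init_form \<Delta> f)) a b
      = (\<Sum>(i, j)\<in>T. b * (of_nat j * f $ i $ j * a ^ i * b ^ (j - 1)))"
    by (simp add: eval_sum sum_distrib_left case_prod_unfold eval_monom)
  also have "\<dots> = (\<Sum>(i, j)\<in>T. of_nat j * (f $ i $ j * a ^ i * b ^ j))"
  proof (rule sum.cong[OF refl], clarify)
    fix i j
    show "b * (of_nat j * f $ i $ j * a ^ i * b ^ (j - 1)) = of_nat j * (f $ i $ j * a ^ i * b ^ j)"
      by (cases j) (simp_all add: algebra_simps)
  qed
  finally show "b * eval2 (deriv_y (init_form \<Delta> f)) a b = (\<Sum>(i, j)\<in>T. of_nat j * (f $ i $ j * a ^ i * b ^ j))" .
qed

text \<open>At a torus point this is the vanishing of g, x g_x and y g_y for the terms in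
  \<open>M\<close>. These conditions are linear in the exponents, so they can be followed through
  integral affine changes of exponents in any characteristic.\<close>

definition facet_singular :: "'a::idom fps fps \<Rightarrow> (nat \<times> nat) set \<Rightarrow> 'a \<Rightarrow> 'a \<Rightarrow> bool" where
  "facet_singular f M a b \<longleftrightarrow> (\<Sum>(i, j)\<in>M. f $ i $ j * a ^ i * b ^ j) = 0
     \<and> (\<Sum>(i, j)\<in>M. of_nat i * (f $ i $ j * a ^ i * b ^ j)) = 0
     \<and> (\<Sum>(i, j)\<in>M. of_nat j * (f $ i $ j * a ^ i * b ^ j)) = 0"

lemma WNND_iff:
  fixes f :: "'a::idom fps fps"
  assumes "f \<noteq> 0"
  shows "WNND f \<longleftrightarrow> (\<forall>p q a b. facet_weights p q (supp f) \<longrightarrow> a \<noteq> 0 \<longrightarrow> b \<noteq> 0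
    \<longrightarrow> \<not> facet_singular f (min_points p q (supp f)) a b)"
proof -
  let ?S = "supp f"
  have key: "eval2 (init_form (min_face p q ?S) f) a b = 0
      \<and> eval2 (deriv_x (init_form (min_face p q ?S) f)) a b = 0
      \<and> eval2 (deriv_y (init_form (min_face p q ?S) f)) a b = 0
      \<longleftrightarrow> facet_singular f (min_points p q ?S) a b"
    if pq: "facet_weights p q ?S" and ab: "a \<noteq> 0" "b \<noteq> 0" for p q a b
  proof -
    let ?T = "{z. real_pt z \<in> min_face p q ?S}"
    have pos: "0 < p" "0 < q" using pq by (auto simp: facet_weights_def)
    have fin: "finite ?T"
      by (rule finite_subset[OF _ finite_under[OF supp_nonempty[OF assms] pos]])
        (auto simp: min_face_eq[OF pos])
    have sub: "min_points p q ?S \<subseteq> ?T" by (auto simp: min_face_def intro: hull_inc)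
    \<comment> \<open>\<open>init_form\<close> runs over all lattice points of the edge; those
      outside the support contribute zero.\<close>
    have "f $ fst z $ snd z = 0" if "z \<in> ?T - min_points p q ?S" for z
      using that by (cases z) (auto simp: min_points_def min_face_eq[OF pos] supp_iff)
    then have "(\<Sum>(i, j)\<in>?T. w i j * (f $ i $ j * a ^ i * b ^ j))
        = (\<Sum>(i, j)\<in>min_points p q ?S. w i j * (f $ i $ j * a ^ i * b ^ j))" for w
      by (intro sum.mono_neutral_right[OF fin sub]) auto
    note restrict = this this[of "\<lambda>i j. 1", simplified]
    show ?thesis
      unfolding facet_singular_def restrict[symmetric] eval2_init_form[OF fin, symmetric]
      using ab by simp
  qed
  show ?thesis
    unfolding WNND_def Let_def newton_facets_eq[OF supp_nonempty[OF assms]]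
    using key by blast
qed

section \<open>The delta invariant\<close>

text \<open>Term by term, a^m times the transformed monomial at (a, b) is the original one at (a, a
  b). The missing weight is recovered from i = (i + j - m) + m - j, an integral combination of the
  three known sums.\<close>

lemma facet_singular_strict_transform_Some_0:
  fixes f :: "'a::idom fps fps"
  assumes f: "f \<noteq> 0" and a: "a \<noteq> 0"
    and sing: "facet_singular (strict_transform (Some 0) f) (min_points p q (blow_x (mult f) (supp f))) a b"
  shows "facet_singular f (min_points p (p + q) (supp f)) a (a * b)"
proof -
  interpret newton_blow_up "supp f" "mult f" using f by (rule newton_blow_up_supp)
  let ?m = "mult f" and ?M = "min_points p (p + q) (supp f)"
  let ?g = "strict_transform (Some 0) f"
  define t where "t i j = f $ i $ j * a ^ i * (a * b) ^ j" for i j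
  have le: "?m \<le> i + j" if "(i, j) \<in> ?M" for i j
    using that order_le by (auto simp: min_points_def)
  have inj: "inj_on (\<lambda>(i, j). (i + j - ?m, j)) ?M"
    by (auto simp: inj_on_def dest!: le)
  have scaled: "a ^ ?m * (?g $ (i + j - ?m) $ j * a ^ (i + j - ?m) * b ^ j) = t i j" if "(i, j) \<in> ?M" for i j
  proof -
    have "?g $ (i + j - ?m) $ j = f $ i $ j"
      unfolding strict_transform_Some_0_coeff using le[OF that] by simp
    moreover have "a ^ ?m * a ^ (i + j - ?m) = a ^ i * a ^ j"
      using le[OF that] by (simp add: power_add[symmetric])
    ultimately show ?thesis by (simp add: t_def power_mult_distrib mult.assoc mult.left_commute)
  qed
  have trans: "(\<Sum>(i, j)\<in>?M. w (i + j - ?m) j * t i j) = a ^ ?m *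
      (\<Sum>(i, j)\<in>min_points p q (blow_x ?m (supp f)). w i j * (?g $ i $ j * a ^ i * b ^ j))" for w
    unfolding min_points_blow_x sum.reindex[OF inj] sum_distrib_left
    by (rule sum.cong[OF refl]) (auto simp: scaled[symmetric] mult.left_commute simp del: strict_transform.simps)
  have s1: "(\<Sum>(i, j)\<in>?M. t i j) = 0"
    using trans[of "\<lambda>i j. 1"] sing by (simp add: facet_singular_def del: strict_transform.simps)
  have s2: "(\<Sum>(i, j)\<in>?M. of_nat (i + j - ?m) * t i j) = 0"
    using trans[of "\<lambda>i j. of_nat i"] sing by (simp add: facet_singular_def del: strict_transform.simps)
  have s3: "(\<Sum>(i, j)\<in>?M. of_nat j * t i j) = 0"
    using trans[of "\<lambda>i j. of_nat j"] sing by (simp add: facet_singular_def del: strict_transform.simps)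
  have "(\<Sum>(i, j)\<in>?M. of_nat i * t i j)
      = (\<Sum>(i, j)\<in>?M. of_nat (i + j - ?m) * t i j + of_nat ?m * t i j - of_nat j * t i j)"
    by (rule sum.cong[OF refl]) (auto simp: of_nat_diff le algebra_simps)
  also have "\<dots> = (\<Sum>(i, j)\<in>?M. of_nat (i + j - ?m) * t i j) + of_nat ?m * (\<Sum>(i, j)\<in>?M. t i j)
      - (\<Sum>(i, j)\<in>?M. of_nat j * t i j)"
    by (simp add: case_prod_unfold sum.distrib sum_subtractf sum_distrib_left)
  finally have "(\<Sum>(i, j)\<in>?M. of_nat i * t i j) = 0" using s1 s2 s3 by simp
  then show ?thesis using s1 s3 by (simp add: facet_singular_def t_def)
qed

lemma facet_singular_strict_transform_None:
  fixes f :: "'a::idom fps fps"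
  assumes f: "f \<noteq> 0" and b: "b \<noteq> 0"
    and sing: "facet_singular (strict_transform None f) (min_points p q (blow_y (mult f) (supp f))) a b"
  shows "facet_singular f (min_points (p + q) q (supp f)) (a * b) b"
proof -
  interpret newton_blow_up "supp f" "mult f" using f by (rule newton_blow_up_supp)
  let ?m = "mult f" and ?M = "min_points (p + q) q (supp f)"
  let ?g = "strict_transform None f"
  define t where "t i j = f $ i $ j * (a * b) ^ i * b ^ j" for i j
  have le: "?m \<le> i + j" if "(i, j) \<in> ?M" for i j
    using that order_le by (auto simp: min_points_def)
  have inj: "inj_on (\<lambda>(i, j). (i, i + j - ?m)) ?M"
    by (auto simp: inj_on_def dest!: le)
  have scaled: "b ^ ?m * (?g $ i $ (i + j - ?m) * a ^ i * b ^ (i + j - ?m)) = t i j" if "(i, j) \<in> ?M" for i j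
  proof -
    have "?g $ i $ (i + j - ?m) = f $ i $ j"
      using le[OF that] by simp
    moreover have "b ^ ?m * b ^ (i + j - ?m) = b ^ i * b ^ j"
      using le[OF that] by (simp add: power_add[symmetric])
    ultimately show ?thesis by (simp add: t_def power_mult_distrib mult.assoc mult.left_commute del: strict_transform.simps)
  qed
  have trans: "(\<Sum>(i, j)\<in>?M. w i (i + j - ?m) * t i j) = b ^ ?m *
      (\<Sum>(i, j)\<in>min_points p q (blow_y ?m (supp f)). w i j * (?g $ i $ j * a ^ i * b ^ j))" for w
    unfolding min_points_blow_y sum.reindex[OF inj] sum_distrib_left
    by (rule sum.cong[OF refl]) (auto simp: scaled[symmetric] mult.left_commute simp del: strict_transform.simps)
  have s1: "(\<Sum>(i, j)\<in>?M. t i j) = 0"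
    using trans[of "\<lambda>i j. 1"] sing by (simp add: facet_singular_def del: strict_transform.simps)
  have s2: "(\<Sum>(i, j)\<in>?M. of_nat i * t i j) = 0"
    using trans[of "\<lambda>i j. of_nat i"] sing by (simp add: facet_singular_def del: strict_transform.simps)
  have s3: "(\<Sum>(i, j)\<in>?M. of_nat (i + j - ?m) * t i j) = 0"
    using trans[of "\<lambda>i j. of_nat j"] sing by (simp add: facet_singular_def del: strict_transform.simps)
  have "(\<Sum>(i, j)\<in>?M. of_nat j * t i j)
      = (\<Sum>(i, j)\<in>?M. of_nat (i + j - ?m) * t i j + of_nat ?m * t i j - of_nat i * t i j)"
    by (rule sum.cong[OF refl]) (auto simp: of_nat_diff le algebra_simps)
  also have "\<dots> = (\<Sum>(i, j)\<in>?M. of_nat (i + j - ?m) * t i j) + of_nat ?m * (\<Sum>(i, j)\<in>?M. t i j)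
      - (\<Sum>(i, j)\<in>?M. of_nat i * t i j)"
    by (simp add: case_prod_unfold sum.distrib sum_subtractf sum_distrib_left)
  finally have "(\<Sum>(i, j)\<in>?M. of_nat j * t i j) = 0" using s1 s2 s3 by simp
  then show ?thesis using s1 s2 by (simp add: facet_singular_def t_def)
qed

lemma WNND_strict_transform:
  fixes f :: "'a::idom fps fps"
  assumes f: "f \<noteq> 0" and W: "WNND f"
  shows "WNND (strict_transform (Some 0) f)" "WNND (strict_transform None f)"
proof -
  interpret newton_blow_up "supp f" "mult f" using f by (rule newton_blow_up_supp)
  note W' = W[unfolded WNND_iff[OF f], rule_format]
  show "WNND (strict_transform (Some 0) f)"
    unfolding WNND_iff[OF strict_transform_nonzero(1)[OF f]] supp_strict_transform_Some_0[OF f]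
    using W' facet_singular_strict_transform_Some_0[OF f]
    by (metis facet_weights_blow_x mult_eq_0_iff)
  show "WNND (strict_transform None f)"
    unfolding WNND_iff[OF strict_transform_nonzero(2)[OF f]] supp_strict_transform_None[OF f]
    using W' facet_singular_strict_transform_None[OF f]
    by (metis facet_weights_blow_y mult_eq_0_iff)
qed

text \<open>
  A point of multiplicity at least two on the exceptional divisor, away from the two torus-fixed
  points, is a multiple root \<open>c\<close> of the tangent cone; by Euler's formula \<open>(1, c)\<close> is then a singular
  point of the initial form of the edge of slope \<open>-1\<close>.
\<close>

lemma WNND_mult_strict_transform_Some:
  fixes f :: "'a::idom fps fps"
  assumes f: "f \<noteq> 0" and W: "WNND f" and c: "c \<noteq> 0"
  shows "mult (strict_transform (Some c) f) \<le> 1"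
proof (rule ccontr)
  assume "\<not> ?thesis"
  then have m2: "2 \<le> mult (strict_transform (Some c) f)" by simp
  interpret newton_blow_up "supp f" "mult f" using f by (rule newton_blow_up_supp)
  let ?m = "mult f" and ?M = "min_points 1 1 (supp f)"
  define t where "t i j = f $ i $ j * 1 ^ i * c ^ j" for i j
  have trans: "(\<Sum>(i, j)\<in>?M. w j * t i j) = (\<Sum>j\<le>?m. w j * (f $ (?m - j) $ j * c ^ j))" for w
  proof -
    have inj: "inj_on snd ?M" by (auto simp: inj_on_def min_points_diagonal)
    have "(\<Sum>j\<le>?m. w j * (f $ (?m - j) $ j * c ^ j)) = (\<Sum>j\<in>snd ` ?M. w j * (f $ (?m - j) $ j * c ^ j))"
    proof (rule sum.mono_neutral_right)
      show "snd ` ?M \<subseteq> {..?m}" by (auto simp: min_points_diagonal)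
      have "f $ (?m - j) $ j = 0" if "j \<le> ?m" "j \<notin> snd ` ?M" for j
      proof (rule ccontr)
        assume "f $ (?m - j) $ j \<noteq> 0"
        then have "(?m - j, j) \<in> ?M" using that(1) by (simp add: min_points_diagonal supp_iff)
        then show False using that(2) by force
      qed
      then show "\<forall>j\<in>{..?m} - snd ` ?M. w j * (f $ (?m - j) $ j * c ^ j) = 0" by auto
    qed simp
    also have "\<dots> = (\<Sum>(i, j)\<in>?M. w j * t i j)"
      unfolding sum.reindex[OF inj]
    proof (rule sum.cong[OF refl], clarify)
      fix i j assume "(i, j) \<in> ?M"
      then have "i + j = ?m" by (simp add: min_points_diagonal)
      then have "?m - j = i" by linarith
      then show "((\<lambda>j. w j * (f $ (?m - j) $ j * c ^ j)) \<circ> snd) (i, j) = w j * t i j"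
        by (simp add: t_def)
    qed
    finally show ?thesis ..
  qed
  have s1: "(\<Sum>(i, j)\<in>?M. t i j) = 0"
    using trans[of "\<lambda>j. 1"] strict_transform_Some_mult_ge_2(1)[OF m2] by simp
  have s3: "(\<Sum>(i, j)\<in>?M. of_nat j * t i j) = 0"
    using trans[of of_nat] strict_transform_Some_mult_ge_2(2)[OF m2] by simp
  have "(\<Sum>(i, j)\<in>?M. of_nat i * t i j) = (\<Sum>(i, j)\<in>?M. of_nat ?m * t i j - of_nat j * t i j)"
  proof (rule sum.cong[OF refl], clarify)
    fix i j assume "(i, j) \<in> ?M"
    then have "?m = i + j" by (simp add: min_points_diagonal)
    then show "of_nat i * t i j = of_nat ?m * t i j - of_nat j * t i j" by (simp add: algebra_simps)
  qed
  also have "\<dots> = of_nat ?m * (\<Sum>(i, j)\<in>?M. t i j) - (\<Sum>(i, j)\<in>?M. of_nat j * t i j)"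
    by (simp add: case_prod_unfold sum_subtractf sum_distrib_left)
  finally have "(\<Sum>(i, j)\<in>?M. of_nat i * t i j) = 0" using s1 s3 by simp
  then have sing: "facet_singular f ?M 1 c" using s1 s3 by (simp add: facet_singular_def t_def)
  \<comment> \<open>Without such an edge the tangent cone is a single monomial, which cannot vanish
    at (1, c).\<close>
  have "facet_weights 1 1 (supp f)"
  proof (rule ccontr)
    assume no: "\<not> facet_weights 1 1 (supp f)"
    obtain i j where u: "(i, j) \<in> ?M" using diagonal_points(2) by blast
    have "?M = {(i, j)}"
      using u no zero_less_one unfolding facet_weights_def by blast
    then have "t i j = 0" using s1 by simp
    moreover have "t i j \<noteq> 0" using u c by (auto simp: t_def min_points_def supp_iff)
    ultimately show False by simp
  qed
  then show False using W[unfolded WNND_iff[OF f]] sing c zero_neq_one by metis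
qed

section \<open>Recursion for the delta invariant\<close>

lemma mult_at_Nil: "mult_at f [] = mult f"
  by (simp add: mult_at_def transform_at_def)

lemma mult_at_Cons: "mult_at f (d # R) = mult_at (strict_transform d f) R"
  by (simp add: mult_at_def transform_at_def)

text \<open>\<open>near_points\<close> grows at the end of the list, by the last blow-up, whereas
  the recursion for delta splits off the first one.\<close>

lemma near_points_Cons_iff:
  "d # R \<in> near_points f \<longleftrightarrow>
     2 \<le> mult f \<and> 1 \<le> mult (strict_transform d f) \<and> R \<in> near_points (strict_transform d f)"
proof
  have "Q = d # R \<Longrightarrow> 2 \<le> mult f \<and> 1 \<le> mult (strict_transform d f) \<and> R \<in> near_points (strict_transform d f)"
    if "Q \<in> near_points f" for Q
    using that
  proof (induction arbitrary: R)
    case (blow_up Q e)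
    show ?case
    proof (cases Q)
      case Nil
      then show ?thesis using blow_up by (auto simp: mult_at_Nil mult_at_Cons intro: near_points.origin)
    next
      case (Cons e' Q')
      then have "e' = d" "R = Q' @ [e]" using blow_up.prems by auto
      moreover from this Cons have "2 \<le> mult f" "1 \<le> mult (strict_transform d f)"
        "Q' \<in> near_points (strict_transform d f)" using blow_up.IH by blast+
      ultimately show ?thesis
        using blow_up.hyps Cons by (auto simp: mult_at_Cons intro: near_points.blow_up)
    qed
  qed simp
  then show "d # R \<in> near_points f \<Longrightarrow>
    2 \<le> mult f \<and> 1 \<le> mult (strict_transform d f) \<and> R \<in> near_points (strict_transform d f)" by blast
next
  assume *: "2 \<le> mult f \<and> 1 \<le> mult (strict_transform d f) \<and> R \<in> near_points (strict_transform d f)"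
  then have "R \<in> near_points (strict_transform d f)" by blast
  then show "d # R \<in> near_points f"
  proof induction
    case origin
    show ?case
      using near_points.blow_up[OF near_points.origin, of f d] * by (simp add: mult_at_Nil mult_at_Cons)
  next
    case (blow_up R e)
    then show ?case
      using near_points.blow_up[of "d # R" f e] by (simp add: mult_at_Cons)
  qed
qed

text \<open>Extension by zero to all lists: the index set no longer depends on \<open>f\<close>, so
  sums can be reindexed along the first blow-up.\<close>

definition point_weight :: "'a::comm_ring_1 fps fps \<Rightarrow> 'a option list \<Rightarrow> enat" where
  "point_weight f Q = (if Q \<in> near_points f then enat (mult_at f Q * (mult_at f Q - 1) div 2) else 0)"

lemma delta_eq_point_weight: "delta f = (\<Sum>\<^sub>\<infinity>Q. point_weight f Q)"
  unfolding delta_def by (rule infsum_cong_neutral) (auto simp: point_weight_def)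

lemma summable_enat: "(g :: 'b \<Rightarrow> enat) summable_on A"
  by (rule nonneg_summable_on_complete) simp

lemma point_weight_Nil: "point_weight f [] = enat (mult f * (mult f - 1) div 2)"
  by (simp add: point_weight_def near_points.origin mult_at_Nil)

lemma point_weight_mult_le_1:
  assumes "mult f \<le> 1"
  shows "point_weight f Q = 0"
proof (cases Q)
  case Nil
  have "mult f * (mult f - 1) div 2 = 0" using assms by (cases "mult f") auto
  then show ?thesis by (simp only: Nil point_weight_Nil zero_enat_def)
next
  case (Cons d R)
  then show ?thesis using assms by (simp add: point_weight_def near_points_Cons_iff)
qed

lemma point_weight_Cons:
  assumes "2 \<le> mult f"
  shows "point_weight f (d # R) = point_weight (strict_transform d f) R"
proof (cases "1 \<le> mult (strict_transform d f)")
  case True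
  then show ?thesis using assms by (simp add: point_weight_def near_points_Cons_iff mult_at_Cons)
next
  \<comment> \<open>The strict transform misses \<open>d\<close>. Then \<open>d # R\<close> is not a
    near point, although [] formally still is one for the transform; its weight is zero because the
    multiplicity is.\<close>
  case False
  then show ?thesis
    by (simp add: point_weight_mult_le_1) (simp add: point_weight_def near_points_Cons_iff)
qed

text \<open>The origin and everything over the two torus-fixed points of the first exceptional
  divisor, the only points that the Newton diagram sees.\<close>

definition fixed_point_lists :: "'a::comm_ring_1 option list set" where
  "fixed_point_lists = {[]} \<union> range ((#) (Some 0)) \<union> range ((#) None)"

lemma infsum_fixed_point_lists:
  fixes f :: "'a::comm_ring_1 fps fps"
  assumes "2 \<le> mult f"
  shows "(\<Sum>\<^sub>\<infinity>Q\<in>fixed_point_lists. point_weight f Q) = enat (mult f * (mult f - 1) div 2)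
    + delta (strict_transform (Some 0) f) + delta (strict_transform None f)"
proof -
  have chart: "(\<Sum>\<^sub>\<infinity>Q\<in>range ((#) d). point_weight f Q) = delta (strict_transform d f)" for d
    by (subst infsum_reindex) (simp_all add: comp_def point_weight_Cons[OF assms] delta_eq_point_weight)
  note Un = infsum_Un_disjoint[OF summable_enat summable_enat]
  have disj: "({[]} \<union> range ((#) (Some 0))) \<inter> range ((#) (None :: 'a option)) = {}"
    "{[]} \<inter> range ((#) (Some (0 :: 'a))) = {}"
    by auto
  show ?thesis
    unfolding fixed_point_lists_def chart[symmetric] Un[OF disj(1)] Un[OF disj(2)]
    by (simp add: point_weight_Nil)
qed

lemma delta_ge:
  assumes "2 \<le> mult f"
  shows "enat (mult f * (mult f - 1) div 2)
    + delta (strict_transform (Some 0) f) + delta (strict_transform None f) \<le> delta f"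
  unfolding infsum_fixed_point_lists[OF assms, symmetric] delta_eq_point_weight[of f]
  by (rule infsum_mono_neutral) (auto simp: summable_enat)

text \<open>At every other point of the exceptional divisor the multiplicity is at most one, so it
  contributes nothing and is not blown up further.\<close>

lemma delta_eq:
  fixes f :: "'a::comm_ring_1 fps fps"
  assumes "2 \<le> mult f" and "\<And>c. c \<noteq> 0 \<Longrightarrow> mult (strict_transform (Some c) f) \<le> 1"
  shows "delta f = enat (mult f * (mult f - 1) div 2)
    + delta (strict_transform (Some 0) f) + delta (strict_transform None f)"
  unfolding infsum_fixed_point_lists[OF assms(1), symmetric] delta_eq_point_weight[of f]
proof (rule infsum_cong_neutral)
  fix Q :: "'a option list" assume Q: "Q \<in> UNIV - fixed_point_lists"
  then obtain d R where dR: "Q = d # R" by (cases Q) (auto simp: fixed_point_lists_def)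
  obtain c where "d = Some c" "c \<noteq> 0"
    using Q dR by (cases d) (auto simp: fixed_point_lists_def)
  then show "point_weight f Q = 0"
    using dR point_weight_Cons[OF assms(1)] point_weight_mult_le_1[OF assms(2)]
    by (simp del: strict_transform.simps)
qed auto

lemma delta_mult_le_1: "mult f \<le> 1 \<Longrightarrow> delta f = 0"
  by (simp add: delta_eq_point_weight point_weight_mult_le_1)

text \<open>A positive functional is at least p + q on positive lattice points, but less than p + q
  at a support point of degree at most one.\<close>

lemma inner_points_mult_le_1:
  assumes "f \<noteq> 0" "mult f \<le> 1"
  shows "inner_points (supp f) = {}"
proof -
  interpret newton_blow_up "supp f" "mult f" using assms(1) by (rule newton_blow_up_supp)
  obtain a b where ab: "(a, b) \<in> supp f" "a + b \<le> 1" using order_attained assms(2) by force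
  have "(i, j) \<notin> inner_points (supp f)" for i j
  proof
    assume "(i, j) \<in> inner_points (supp f)"
    then obtain p q where ij: "1 \<le> i" "1 \<le> j" and pq: "0 < p" "0 < q" "under p q (supp f) (real_pt (i, j))"
      by (auto simp: inner_points_def region_def)
    have le: "p * real i + q * real j \<le> p * real a + q * real b"
      using underD[OF pq(3) ab(1)] by (simp add: real_pt_def)
    have "p * 1 \<le> p * real i" "q * 1 \<le> q * real j" using ij pq by (auto intro!: mult_left_mono)
    moreover have "p * real a + q * real b < p + q"
    proof -
      consider "a = 0" "b = 0" | "a = 1" "b = 0" | "a = 0" "b = 1" using ab(2) by linarith
      then show ?thesis using pq by cases simp_all
    qed
    ultimately show False using le by linarith
  qed
  then show ?thesis by auto
qed

section \<open>Comparison of the two recursions\<close>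

lemma esize_inner_points_strict_transform:
  assumes "f \<noteq> 0"
  shows "esize (inner_points (supp f)) = enat (mult f * (mult f - 1) div 2)
    + esize (inner_points (supp (strict_transform (Some 0) f)))
    + esize (inner_points (supp (strict_transform None f)))"
proof -
  interpret newton_blow_up "supp f" "mult f" using assms by (rule newton_blow_up_supp)
  show ?thesis
    unfolding supp_strict_transform_Some_0[OF assms] supp_strict_transform_None[OF assms]
    using finite_inner_points_iff card_inner_points by (auto simp: esize_def)
qed

lemma mult_pred_ge_1: "2 \<le> (m :: nat) \<Longrightarrow> 1 \<le> m * (m - 1) div 2"
proof -
  assume "2 \<le> m"
  then have "2 * 1 \<le> m * (m - 1)" by (intro mult_le_mono) auto
  then show ?thesis by simp
qed

text \<open>For finite delta the induction is on its value: a point of multiplicity at least 2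
  contributes at least 1, so both transforms have smaller delta.\<close>

lemma esize_le_delta:
  fixes f :: "'a::idom fps fps"
  assumes "f \<noteq> 0"
  shows "esize (inner_points (supp f)) \<le> delta f"
proof (cases "delta f")
  case (enat n)
  then show ?thesis
    using assms
  proof (induction n arbitrary: f rule: less_induct)
    case (less n)
    show ?case
    proof (cases "mult f \<le> 1")
      case True
      then show ?thesis using less.prems by (simp add: inner_points_mult_le_1 esize_def zero_enat_def[symmetric])
    next
      case False
      let ?g = "strict_transform (Some 0) f" and ?h = "strict_transform None f"
      have m2: "2 \<le> mult f" using False by simp
      note ge = delta_ge[OF m2]
      then obtain k l where kl: "delta ?g = enat k" "delta ?h = enat l"
        using less.prems(1) by (cases "delta ?g"; cases "delta ?h") (auto simp del: strict_transform.simps)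
      have "k < n" "l < n"
        using ge mult_pred_ge_1[OF m2] unfolding kl less.prems(1) by (auto simp del: strict_transform.simps)
      then have "esize (inner_points (supp ?g)) \<le> delta ?g" "esize (inner_points (supp ?h)) \<le> delta ?h"
        using less.IH kl strict_transform_nonzero[OF less.prems(2)] by blast+
      then have "esize (inner_points (supp f)) \<le> enat (mult f * (mult f - 1) div 2) + delta ?g + delta ?h"
        unfolding esize_inner_points_strict_transform[OF less.prems(2)] by (intro add_mono order_refl)
      also note ge
      finally show ?thesis .
    qed
  qed
qed simp

text \<open>Finiteness of delta is not known in advance, so the induction is on the number of inner
  points. If that number is infinite, the inequality already forces equality.\<close>

lemma delta_eq_esize:
  fixes f :: "'a::idom fps fps"
  assumes "f \<noteq> 0" "WNND f"
  shows "delta f = esize (inner_points (supp f))"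
proof (cases "finite (inner_points (supp f))")
  case False
  then show ?thesis using esize_le_delta[OF assms(1)] by (simp add: esize_def)
next
  case True
  then show ?thesis
    using assms
  proof (induction "card (inner_points (supp f))" arbitrary: f rule: less_induct)
    case less
    show ?case
    proof (cases "mult f \<le> 1")
      case True
      then show ?thesis
        using less.prems by (simp add: inner_points_mult_le_1 delta_mult_le_1 esize_def zero_enat_def[symmetric])
    next
      case False
      let ?g = "strict_transform (Some 0) f" and ?h = "strict_transform None f"
      have m2: "2 \<le> mult f" using False by simp
      note f = less.prems(2)
      interpret newton_blow_up "supp f" "mult f" using f by (rule newton_blow_up_supp)
      note supps = supp_strict_transform_Some_0[OF f] supp_strict_transform_None[OF f]
      have "card (inner_points (supp ?g)) < card (inner_points (supp f))"
        "card (inner_points (supp ?h)) < card (inner_points (supp f))"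
        using card_inner_points[OF less.prems(1)] mult_pred_ge_1[OF m2] unfolding supps by linarith+
      moreover have "finite (inner_points (supp ?g))" "finite (inner_points (supp ?h))"
        using less.prems(1) unfolding supps finite_inner_points_iff by blast+
      ultimately have "delta ?g = esize (inner_points (supp ?g))" "delta ?h = esize (inner_points (supp ?h))"
        using less.hyps strict_transform_nonzero[OF f] WNND_strict_transform[OF f less.prems(3)] by blast+
      then show ?thesis
        unfolding esize_inner_points_strict_transform[OF f]
        using delta_eq[OF m2] WNND_mult_strict_transform_Some[OF f less.prems(3)] by metis
    qed
  qed
qed

theorem proposition4p9:
  fixes f :: "'a::alg_closed_field fps fps"
  assumes "f \<noteq> 0" and "f \<in> ideal_xy"
  shows "delta_N f \<le> ereal_of_enat (delta f) \<and>
         (WNND f \<longrightarrow> delta_N f = ereal_of_enat (delta f))"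
  using esize_le_delta[OF assms(1)] delta_eq_esize[OF assms(1)] by (simp add: delta_N_eq[OF assms(1)])

end
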